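(* If a function $f$ is computable by an $M$-memory $(T(n),IO(n))$-time $S(n)$-space TM-TLM, then there is an $O(T(n)+IO(n)\cdot S(n))$-time Turing machine that computes $f$.
   Context: A Turing machine with two-level memory (TM-TLM) with main memory size $M$ has three tapes: a main memory tape of $M$ cells, an unbounded external memory tape, and an address tape for the external memory. It has a finite state set, input alphabet $\Sigma$, tape alphabet $\Gamma\supseteq\Sigma$ with a blank, an accepting state, and a transition function $\delta: Q\times\Gamma\to Q\times\Gamma\times\{L,S,R\}$ acting on the main memory tape. There are special read states and write states: on entering a read state the machine writes an address $addr$ on the address tape and the main memory cell under the head receives the content of external cell $addr$; on entering a write state it writes $addr$ and external cell $addr$ receives the content of the main memory cell under the head. Each Read/Write is one IO operation of unit cost. For input $x$: the time is the number of transitions other than Read/Write; the IO time is the number of Read/Write operations; the space is the number of external tape cells used. An $M$-memory $(T(n),IO(n))$-time $S(n)$-space TM-TLM has main memory size $M$, and time, IO and space complexities $O(T(n))$, $O(IO(n))$, $O(S(n))$ respectively (each measure bounded accordingly for almost all $n$ and all inputs of length $n$). It is assumed that $M<n$. "Turing machine" means a classical (multi-tape) deterministic Turing machine.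
   Formalization: Space is taken as the largest accessed external address plus one, since counting only distinct accessed cells makes the claim false; and the transition function also operates the address tape (binary), its moves counting as time, since the model leaves the address unspecified. *)

theory Defs
  imports Main
begin

text \<open>Symbols and states are natural numbers; the blank symbol is 0.
  Tapes are one-way infinite (cells indexed by nat); moving left at cell 0 stays.\<close>

datatype dir = Lft | Stay | Rgt

fun mv :: "dir \<Rightarrow> nat \<Rightarrow> nat" where
  "mv Lft p = p - 1"
| "mv Stay p = p"
| "mv Rgt p = Suc p"

definition tape_word :: "(nat \<Rightarrow> nat) \<Rightarrow> nat list" where
  "tape_word t = map t [0..<(LEAST j. t j = 0)]"

record tm =
  tm_k :: nat
  tm_Q :: "nat set"
  tm_G :: "nat set"
  tm_q0 :: nat
  tm_qf :: nat
  tm_delta :: "nat \<Rightarrow> nat list \<Rightarrow> nat \<times> nat list \<times> dir list"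

record tm_conf =
  st :: nat
  tp :: "nat \<Rightarrow> nat \<Rightarrow> nat"
  hd :: "nat \<Rightarrow> nat"

definition tm_wf :: "tm \<Rightarrow> bool" where
  "tm_wf P \<longleftrightarrow> 1 \<le> tm_k P \<and> finite (tm_Q P) \<and> finite (tm_G P) \<and> 0 \<in> tm_G P \<and>
     tm_q0 P \<in> tm_Q P \<and> tm_qf P \<in> tm_Q P \<and>
     (\<forall>q \<in> tm_Q P - {tm_qf P}. \<forall>as. length as = tm_k P \<and> set as \<subseteq> tm_G P \<longrightarrow>
        (case tm_delta P q as of (q', ws, ds) \<Rightarrow>
          q' \<in> tm_Q P \<and> length ws = tm_k P \<and> set ws \<subseteq> tm_G P \<and> length ds = tm_k P))"

definition tm_step :: "tm \<Rightarrow> tm_conf \<Rightarrow> tm_conf" where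
  "tm_step P c = (if st c = tm_qf P then c else
     (case tm_delta P (st c) (map (\<lambda>i. tp c i (hd c i)) [0..<tm_k P]) of (q', ws, ds) \<Rightarrow>
       \<lparr> st = q',
         tp = (\<lambda>i. if i < tm_k P then (tp c i)(hd c i := ws ! i) else tp c i),
         hd = (\<lambda>i. if i < tm_k P then mv (ds ! i) (hd c i) else hd c i) \<rparr>))"

definition tm_init :: "tm \<Rightarrow> nat list \<Rightarrow> tm_conf" where
  "tm_init P x = \<lparr> st = tm_q0 P,
                   tp = (\<lambda>i j. if i = 0 \<and> j < length x then x ! j else 0),
                   hd = (\<lambda>i. 0) \<rparr>"

definition tm_run :: "tm \<Rightarrow> nat list \<Rightarrow> nat \<Rightarrow> tm_conf" where
  "tm_run P x s = (tm_step P ^^ s) (tm_init P x)"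

definition tm_computes_in_time ::
  "tm \<Rightarrow> nat set \<Rightarrow> (nat list \<Rightarrow> nat list) \<Rightarrow> (nat \<Rightarrow> nat) \<Rightarrow> bool" where
  "tm_computes_in_time P \<Sigma> f t \<longleftrightarrow> tm_wf P \<and> \<Sigma> \<subseteq> tm_G P \<and> 0 \<notin> \<Sigma> \<and>
     (\<forall>x \<in> lists \<Sigma>. \<exists>s. st (tm_run P x s) = tm_qf P \<and> tape_word (tp (tm_run P x s) 0) = f x) \<and>
     (\<exists>c N. \<forall>x \<in> lists \<Sigma>. N \<le> length x \<longrightarrow>
        (\<exists>s \<le> c * t (length x). st (tm_run P x s) = tm_qf P))"

text \<open>Address-tape symbols: 0 = blank, 1 = bit 0, 2 = bit 1. The address is the number whose
  binary representation (least significant bit at cell 0) is the word on the address tape.\<close>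
definition addr_of :: "(nat \<Rightarrow> nat) \<Rightarrow> nat" where
  "addr_of t = (\<Sum>j < (LEAST j. t j = 0). (t j - 1) * 2 ^ j)"

record tlm =
  tl_Q :: "nat set"
  tl_G :: "nat set"
  tl_q0 :: nat
  tl_acc :: nat
  tl_R :: "nat set"
  tl_W :: "nat set"
  tl_delta :: "nat \<Rightarrow> nat \<Rightarrow> nat \<Rightarrow> nat \<times> nat \<times> dir \<times> nat \<times> dir"

record tl_conf =
  cst :: nat
  mem :: "nat \<Rightarrow> nat"
  mh :: nat
  ext :: "nat \<Rightarrow> nat"
  atape :: "nat \<Rightarrow> nat"
  ah :: nat

definition tl_wf :: "nat \<Rightarrow> tlm \<Rightarrow> bool" where
  "tl_wf M P \<longleftrightarrow> 0 < M \<and> finite (tl_Q P) \<and> finite (tl_G P) \<and> 0 \<in> tl_G P \<and>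
     tl_q0 P \<in> tl_Q P \<and> tl_acc P \<in> tl_Q P \<and> tl_R P \<subseteq> tl_Q P \<and> tl_W P \<subseteq> tl_Q P \<and>
     tl_R P \<inter> tl_W P = {} \<and> tl_acc P \<notin> tl_R P \<union> tl_W P \<and>
     (\<forall>q \<in> tl_Q P - {tl_acc P}. \<forall>a \<in> tl_G P. \<forall>b \<in> {0,1,2}.
        (case tl_delta P q a b of (q', w, d, aw, ad) \<Rightarrow>
          q' \<in> tl_Q P \<and> w \<in> tl_G P \<and> aw \<in> {0,1,2}))"

definition tl_step :: "nat \<Rightarrow> tlm \<Rightarrow> tl_conf \<Rightarrow> tl_conf" where
  "tl_step M P c = (if cst c = tl_acc P then c else
     (case tl_delta P (cst c) (mem c (mh c)) (atape c (ah c)) of (q', w, d, aw, ad) \<Rightarrow>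
       (let m1 = (mem c)(mh c := w);
            h1 = min (M - 1) (mv d (mh c));
            a1 = (atape c)(ah c := aw);
            adr = addr_of a1
        in \<lparr> cst = q',
             mem = (if q' \<in> tl_R P then m1(h1 := ext c adr) else m1),
             mh = h1,
             ext = (if q' \<in> tl_W P then (ext c)(adr := m1 h1) else ext c),
             atape = a1,
             ah = mv ad (ah c) \<rparr>)))"

definition tl_init :: "tlm \<Rightarrow> nat list \<Rightarrow> tl_conf" where
  "tl_init P x = \<lparr> cst = tl_q0 P, mem = (\<lambda>j. 0), mh = 0,
                   ext = (\<lambda>j. if j < length x then x ! j else 0),
                   atape = (\<lambda>j. 0), ah = 0 \<rparr>"

definition tl_run :: "nat \<Rightarrow> tlm \<Rightarrow> nat list \<Rightarrow> nat \<Rightarrow> tl_conf" where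
  "tl_run M P x s = (tl_step M P ^^ s) (tl_init P x)"

definition tl_is_io :: "nat \<Rightarrow> tlm \<Rightarrow> nat list \<Rightarrow> nat \<Rightarrow> bool" where
  "tl_is_io M P x i \<longleftrightarrow> cst (tl_run M P x (Suc i)) \<in> tl_R P \<union> tl_W P"

definition tl_time :: "nat \<Rightarrow> tlm \<Rightarrow> nat list \<Rightarrow> nat \<Rightarrow> nat" where
  "tl_time M P x s = card {i. i < s \<and> \<not> tl_is_io M P x i}"

definition tl_io :: "nat \<Rightarrow> tlm \<Rightarrow> nat list \<Rightarrow> nat \<Rightarrow> nat" where
  "tl_io M P x s = card {i. i < s \<and> tl_is_io M P x i}"

definition tl_space :: "nat \<Rightarrow> tlm \<Rightarrow> nat list \<Rightarrow> nat \<Rightarrow> nat" where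
  "tl_space M P x s = (if \<exists>i < s. tl_is_io M P x i
     then Suc (Max {addr_of (atape (tl_run M P x (Suc i))) | i. i < s \<and> tl_is_io M P x i})
     else 0)"

definition tlm_computes ::
  "nat \<Rightarrow> tlm \<Rightarrow> nat set \<Rightarrow> (nat list \<Rightarrow> nat list) \<Rightarrow>
   (nat \<Rightarrow> nat) \<Rightarrow> (nat \<Rightarrow> nat) \<Rightarrow> (nat \<Rightarrow> nat) \<Rightarrow> bool" where
  "tlm_computes M P \<Sigma> f T IO S \<longleftrightarrow> tl_wf M P \<and> \<Sigma> \<subseteq> tl_G P \<and> 0 \<notin> \<Sigma> \<and>
     (\<forall>x \<in> lists \<Sigma>. \<exists>s. cst (tl_run M P x s) = tl_acc P \<and>
                         tape_word (ext (tl_run M P x s)) = f x) \<and>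
     (\<exists>c N. \<forall>x \<in> lists \<Sigma>. N \<le> length x \<longrightarrow>
        (\<forall>s. cst (tl_run M P x s) = tl_acc P \<and> (\<forall>i < s. cst (tl_run M P x i) \<noteq> tl_acc P) \<longrightarrow>
           tl_time M P x s \<le> c * T (length x) \<and>
           tl_io M P x s \<le> c * IO (length x) \<and>
           tl_space M P x s \<le> c * S (length x)))"

end

theory Submission
  imports Defs
begin

text \<open>The main memory is bounded, so it is kept in the finite control; the external memory is tape 0 and
  the address tape is copied verbatim. Accessing address \<open>a\<close> means moving the head of tape 0 to cell \<open>a\<close>,
  which Horner's scheme with unary doubling does in \<open>O(a)\<close> steps, once the head of the address tape
  is on the highest 1-bit.

  The difficulty is that the address word may have far more leading zeros than \<open>S(n)\<close>, and the address head
  may be far out among them, so reading the whole word at every access is too expensive.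
  Two additional tracks of the address tape let the machine recognise in constant time that the address
  has not changed since the last access: one records for each cell right of the head whether the word
  still has a 1-bit further to the right, the other summarises for each cell left of the head the prefix
  before that cell. If the address may have changed, then the head has been near the
  1-bits of the address since the last access, so its distance from cell 0 is at most \<open>S(n)\<close> plus
  the number of steps since then, and recomputing the address is paid for by these steps.\<close>

section \<open>The address word and its tracks\<close>

text \<open>By truncated subtraction a blank contributes 0, so a sum may include the blank that ends
  the word.\<close>

definition psum :: "(nat \<Rightarrow> nat) \<Rightarrow> nat \<Rightarrow> nat" where
  "psum t j = (\<Sum>i<j. (t i - 1) * 2 ^ i)"

text \<open>Cells left of \<open>j\<close> do not matter, so a write there preserves it. The suffix
  track at cell \<open>j\<close> stores this property for \<open>Suc j\<close>.\<close>

definition live :: "(nat \<Rightarrow> nat) \<Rightarrow> nat \<Rightarrow> bool" where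
  "live t j \<longleftrightarrow> (\<exists>i\<ge>j. t i = 2 \<and> (\<forall>k. j \<le> k \<and> k \<le> i \<longrightarrow> t k \<noteq> 0))"

lemma live_rec: "live t j \<longleftrightarrow> t j = 2 \<or> (t j \<noteq> 0 \<and> live t (Suc j))"
proof
  assume "live t j"
  then obtain i where i: "j \<le> i" "t i = 2" "\<forall>k. j \<le> k \<and> k \<le> i \<longrightarrow> t k \<noteq> 0"
    unfolding live_def by blast
  show "t j = 2 \<or> (t j \<noteq> 0 \<and> live t (Suc j))"
  proof (cases "i = j")
    case False
    then have "Suc j \<le> i" using i(1) by simp
    then show ?thesis using i unfolding live_def by (metis Suc_leD order_refl)
  qed (use i in simp)
next
  assume "t j = 2 \<or> (t j \<noteq> 0 \<and> live t (Suc j))"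
  then show "live t j"
  proof
    assume "t j = 2"
    then show ?thesis unfolding live_def by (intro exI[of _ j]) auto
  next
    assume "t j \<noteq> 0 \<and> live t (Suc j)"
    then obtain i where "t j \<noteq> 0" "Suc j \<le> i" "t i = 2"
      "\<forall>k. Suc j \<le> k \<and> k \<le> i \<longrightarrow> t k \<noteq> 0" unfolding live_def by blast
    then show ?thesis unfolding live_def
      by (intro exI[of _ i]) (metis Suc_leD le_antisym not_less_eq_eq)
  qed
qed

lemma live_cong:
  assumes "\<And>i. j \<le> i \<Longrightarrow> t i = t' i"
  shows "live t j \<longleftrightarrow> live t' j"
  using assms unfolding live_def by (metis le_trans)

lemma psum_Suc: "psum t (Suc j) = psum t j + (t j - 1) * 2 ^ j"
  by (simp add: psum_def)

lemma psum_cong: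
  assumes "\<And>i. i < j \<Longrightarrow> t i = t' i"
  shows "psum t j = psum t' j"
  using assms by (simp add: psum_def)

lemma psum_mono: "i \<le> j \<Longrightarrow> psum t i \<le> psum t j"
  unfolding psum_def by (intro sum_mono2) auto

lemma addr_of_eq_psum:
  assumes "\<forall>i<j. t i \<noteq> 0" "t j = 0"
  shows "addr_of t = psum t j"
proof -
  have "(LEAST j. t j = 0) = j"
    using assms by (intro Least_equality) (auto simp: not_less[symmetric])
  then show ?thesis by (simp add: addr_of_def psum_def)
qed

lemma first_blank:
  fixes t :: "nat \<Rightarrow> nat"
  assumes "\<exists>j. t j = 0"
  obtains j where "\<forall>i<j. t i \<noteq> 0" "t j = 0"
  using assms exists_least_iff[of "\<lambda>j. t j = 0"] by blast

text \<open>The word ends at its first blank, which lies at or before the blank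
  \<open>j\<close>.\<close>

lemma addr_of_cong:
  assumes "t j = 0" "\<And>i. i \<le> j \<Longrightarrow> t i = t' i"
  shows "addr_of t = addr_of t'"
proof -
  obtain l where l: "\<forall>i<l. t i \<noteq> 0" "t l = 0" using assms(1) first_blank by blast
  have "l \<le> j" using l(1) assms(1) not_less by blast
  then have eq: "\<And>i. i \<le> l \<Longrightarrow> t i = t' i" using assms(2) by simp
  have "\<forall>i<l. t' i \<noteq> 0" "t' l = 0" using l eq by (metis less_imp_le, metis order_refl)
  then have "addr_of t' = psum t' l" by (rule addr_of_eq_psum)
  also have "\<dots> = psum t l" by (rule psum_cong) (simp add: eq)
  finally show ?thesis using addr_of_eq_psum[OF l] by simp
qed

lemma psum_le_addr_of:
  assumes "\<exists>j. t j = 0" "\<forall>i<j. t i \<noteq> 0"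
  shows "psum t j \<le> addr_of t"
proof -
  obtain l where l: "\<forall>i<l. t i \<noteq> 0" "t l = 0" using assms(1) first_blank by blast
  have "j \<le> l" using assms(2) l(2) not_less by blast
  then show ?thesis using psum_mono addr_of_eq_psum[OF l] by simp
qed

text \<open>The bit at \<open>d\<close> alone contributes \<open>2 ^ d\<close>. This turns head
  positions into quantities bounded by the address.\<close>

lemma one_bit_less_addr_of:
  assumes "\<exists>j. t j = 0" "\<forall>i\<le>d. t i \<noteq> 0" "t d = 2"
  shows "d < addr_of t"
proof -
  have "d < 2 ^ d" by simp
  also have "\<dots> \<le> psum t (Suc d)" using assms(3) by (simp add: psum_Suc)
  also have "\<dots> \<le> addr_of t" using assms by (intro psum_le_addr_of) auto
  finally show ?thesis .
qed

lemma live_less_addr_of: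
  assumes "\<exists>j. t j = 0" "\<forall>i<j. t i \<noteq> 0" "live t j"
  shows "j < addr_of t"
proof -
  obtain i where i: "j \<le> i" "t i = 2" "\<forall>k. j \<le> k \<and> k \<le> i \<longrightarrow> t k \<noteq> 0"
    using assms(3) unfolding live_def by blast
  have "\<forall>k\<le>i. t k \<noteq> 0" using i(3) assms(2) by (metis not_less)
  then have "i < addr_of t" using assms(1) i(2) one_bit_less_addr_of by blast
  then show ?thesis using i(1) by simp
qed

text \<open>From \<open>j\<close> up to the first blank there are only 0-bits, so the sum no longer
  grows.\<close>

lemma addr_of_not_live:
  assumes "\<exists>j. t j = 0" "\<forall>i<j. t i \<noteq> 0" "\<not> live t j" "\<forall>i. t i \<le> 2"
  shows "addr_of t = psum t j"
proof -
  obtain l where l: "\<forall>i<l. t i \<noteq> 0" "t l = 0" using assms(1) first_blank by blast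
  have jl: "j \<le> l" using assms(2) l(2) not_less by blast
  have one: "t i - 1 = 0" if "j \<le> i" "i < l" for i
  proof -
    have "t i \<noteq> 2" using assms(3) that l(1) unfolding live_def by (metis order.strict_trans1)
    then show ?thesis using assms(4)[rule_format, of i] by simp
  qed
  have "psum t l = psum t j" unfolding psum_def
    using jl one by (intro sum.mono_neutral_right) (auto simp: not_less)
  then show ?thesis using addr_of_eq_psum[OF l] by simp
qed

text \<open>Marks of the prefix track, relative to the cell \<open>e\<close> under the head of tape 0: mark 1 at cell \<open>j\<close>
  says that the word reaches \<open>j\<close> and its bits before \<open>j\<close> have value \<open>e\<close>; mark 2 says that the word ends
  before \<open>j\<close> and has value \<open>e\<close>; mark 0 makes no claim and forces a recomputation. Every mark depends only on
  cells to its left, hence stays valid while the head is at or to the right of it.\<close>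
definition pnext :: "nat \<Rightarrow> nat \<Rightarrow> nat" where
  "pnext r a = (if r = 1 then (if a = 0 then 2 else if a = 1 then 1 else 0)
                else if r = 2 then 2 else 0)"

definition pval :: "(nat \<Rightarrow> nat) \<Rightarrow> nat \<Rightarrow> nat \<Rightarrow> nat \<Rightarrow> bool" where
  "pval A e j r \<longleftrightarrow> (r = 1 \<longrightarrow> (\<forall>i<j. A i \<noteq> 0) \<and> psum A j = e) \<and>
                   (r = 2 \<longrightarrow> (\<exists>i<j. A i = 0) \<and> addr_of A = e)"

lemma pval_next:
  assumes "pval A e j r"
  shows "pval A e (Suc j) (pnext r (A j))"
proof (cases "r = 1")
  case True
  then have h: "\<forall>i<j. A i \<noteq> 0" "psum A j = e" using assms by (auto simp: pval_def)
  then show ?thesis using True addr_of_eq_psum[of j A]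
    by (auto simp: pval_def pnext_def psum_Suc less_Suc_eq)
next
  case False
  then show ?thesis using assms by (auto simp: pval_def pnext_def less_Suc_eq)
qed

lemma pval_upd:
  assumes "pval A e j r" "j \<le> h"
  shows "pval (A(h := a)) e j r"
proof -
  have "psum (A(h := a)) j = psum A j" using assms(2) by (intro psum_cong) auto
  moreover have "addr_of (A(h := a)) = addr_of A" if "i < j" "A i = 0" for i
    using addr_of_cong[of A i "A(h := a)"] that assms(2) by auto
  ultimately show ?thesis using assms unfolding pval_def by (auto intro!: exI)
qed

text \<open>Soundness of the constant-time test in \<open>Chk\<close>. With mark 2 the word ended
  before the head; with mark 1 the part of the word from the head on is empty or has no 1-bit, so
  the prefix has the full value.\<close>

lemma pval_clean:
  assumes "pval A e h r" "\<exists>j. A j = 0" "\<forall>i. A i \<le> 2"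
    "r = 2 \<or> (r = 1 \<and> (A h = 0 \<or> (A h = 1 \<and> \<not> live A (Suc h))))"
  shows "addr_of A = e"
  using assms(4)
proof (elim disjE conjE)
  assume "r = 1" "A h = 0"
  then show ?thesis using assms(1) addr_of_eq_psum[of h A] by (auto simp: pval_def)
next
  assume r: "r = 1" and h: "A h = 1" "\<not> live A (Suc h)"
  then have p: "\<forall>i<h. A i \<noteq> 0" "psum A h = e" using assms(1) by (auto simp: pval_def)
  have "\<not> live A h" using h live_rec[of A h] by simp
  then show ?thesis using addr_of_not_live[OF assms(2) p(1)] assms(3) p(2) by simp
qed (use assms(1) in \<open>auto simp: pval_def\<close>)

text \<open>Here \<open>s\<close> and \<open>p\<close> are the suffix and the prefix track, \<open>h\<close> is the address head, \<open>S\<close> exceeds all accessed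
  addresses, and \<open>k\<close> counts the steps since the last access. The last two clauses
  are for the time bound: a mark 0 beyond \<open>S\<close> extends up to the head, and
  the head is then within \<open>k\<close> of \<open>S\<close> or of a 1-bit of the address.\<close>
definition core :: "nat \<Rightarrow> nat \<Rightarrow> (nat \<Rightarrow> nat) \<Rightarrow> (nat \<Rightarrow> nat) \<Rightarrow> (nat \<Rightarrow> nat) \<Rightarrow> nat \<Rightarrow> nat \<Rightarrow> bool" where
  "core S k A s p e h \<longleftrightarrow>
     (\<forall>j\<ge>h. s j = of_bool (live A (Suc j))) \<and>
     (\<forall>j. p j \<le> 2) \<and> (\<forall>j\<le>h. pval A e j (p j)) \<and>
     (\<forall>i j. i \<le> j \<and> j \<le> h \<and> p i = 0 \<and> p j \<noteq> 0 \<longrightarrow> i \<le> S) \<and>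
     (\<forall>j\<le>h. p j = 0 \<longrightarrow> j \<le> S \<or> h \<le> S + k \<or>
        (\<exists>d<j. A d = 2 \<and> (\<forall>i\<le>d. A i \<noteq> 0) \<and> h \<le> d + k))"

section \<open>Preservation of the track invariant by address-tape steps\<close>

text \<open>Suffix marks from the head on depend on cells strictly right of it, prefix marks up to
  the head on cells strictly left of it, so the scanned cell may change.\<close>

lemma core_write:
  assumes "core S k A s p e h"
  shows "core S k (A(h := a)) s p e h"
proof -
  let ?A = "A(h := a)"
  have lv: "live ?A (Suc j) = live A (Suc j)" if "h \<le> j" for j
    using that by (intro live_cong) auto
  have "\<exists>d<j. ?A d = 2 \<and> (\<forall>i\<le>d. ?A i \<noteq> 0) \<and> h \<le> d + k"
    if "d < j" "j \<le> h" "A d = 2" "\<forall>i\<le>d. A i \<noteq> 0" "h \<le> d + k" for d j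
    using that by (intro exI[of _ d]) auto
  then show ?thesis using assms unfolding core_def
    by (simp add: lv pval_upd del: fun_upd_apply) blast
qed

lemma core_mono:
  assumes "core S k A s p e h" "k \<le> k'"
  shows "core S k' A s p e h"
proof -
  have "\<exists>d<j. A d = 2 \<and> (\<forall>i\<le>d. A i \<noteq> 0) \<and> h \<le> d + k'"
    if "d < j" "A d = 2" "\<forall>i\<le>d. A i \<noteq> 0" "h \<le> d + k" for d j
    using that assms(2) by (intro exI[of _ d]) auto
  moreover have "h \<le> S + k \<Longrightarrow> h \<le> S + k'" using assms(2) by simp
  ultimately show ?thesis using assms(1) unfolding core_def by blast
qed

definition lbit :: "nat \<Rightarrow> nat \<Rightarrow> nat" where
  "lbit a s = of_bool (a = 2 \<or> (a = 1 \<and> s = 1))"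

lemma lbit_live: "A j \<le> 2 \<Longrightarrow> lbit (A j) (of_bool (live A (Suc j))) = of_bool (live A j)"
  using live_rec[of A j] by (auto simp: lbit_def)

text \<open>Only the suffix entry of the cell entered can be stale; \<open>live_rec\<close> recovers
  it from the cell just left.\<close>

lemma core_left:
  assumes "core S k A s p e (Suc h)" "\<forall>j. A j \<le> 2"
  shows "core S k A (s(h := lbit (A (Suc h)) (s (Suc h)))) p e h"
proof -
  note c = assms(1)[unfolded core_def]
  have "s (Suc h) = of_bool (live A (Suc (Suc h)))" using c by simp
  then have l: "lbit (A (Suc h)) (s (Suc h)) = of_bool (live A (Suc h))"
    using lbit_live assms(2) by simp
  have "\<forall>j\<ge>h. (s(h := lbit (A (Suc h)) (s (Suc h)))) j = of_bool (live A (Suc j))"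
    using c l by (simp add: Suc_le_eq)
  moreover have "\<forall>j\<le>h. pval A e j (p j)" using c by simp
  moreover have "i \<le> S" if "i \<le> j" "j \<le> h" "p i = 0" "p j \<noteq> 0" for i j
    using c that le_SucI by blast
  moreover have "j \<le> S \<or> h \<le> S + k \<or>
        (\<exists>d<j. A d = 2 \<and> (\<forall>i\<le>d. A i \<noteq> 0) \<and> h \<le> d + k)" if j: "j \<le> h" "p j = 0" for j
  proof -
    have "j \<le> S \<or> Suc h \<le> S + k \<or>
        (\<exists>d<j. A d = 2 \<and> (\<forall>i\<le>d. A i \<noteq> 0) \<and> Suc h \<le> d + k)"
      using c j le_SucI by blast
    then show ?thesis using Suc_leD by blast
  qed
  ultimately show ?thesis using c unfolding core_def by blast
qed

text \<open>The prefix mark of the cell entered follows from the cell just left. The head advances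
  by one and so does \<open>k\<close>, so the distance bounds survive.\<close>

lemma core_right:
  assumes "core S k A s p e h" "\<forall>j. A j \<le> 2"
  shows "core S (Suc k) A s (p(Suc h := pnext (p h) (A h))) e (Suc h)"
proof -
  let ?p = "p(Suc h := pnext (p h) (A h))"
  note c = assms(1)[unfolded core_def]
  have c4: "i \<le> S" if "i \<le> j" "j \<le> h" "p i = 0" "p j \<noteq> 0" for i j using c that by blast
  have c5: "j \<le> S \<or> h \<le> S + k \<or>
        (\<exists>d<j. A d = 2 \<and> (\<forall>i\<le>d. A i \<noteq> 0) \<and> h \<le> d + k)" if "j \<le> h" "p j = 0" for j
    using c that by blast
  have ph: "p h \<le> 2" "pval A e h (p h)" using c by auto
  have "\<forall>j\<ge>Suc h. s j = of_bool (live A (Suc j))" using c by simp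
  moreover have "\<forall>j. ?p j \<le> 2" using c by (auto simp: pnext_def)
  moreover have "\<forall>j\<le>Suc h. pval A e j (?p j)"
    using c pval_next[of A e h "p h"] by (auto simp: le_Suc_eq)
  moreover have "i \<le> S" if ij: "i \<le> j" "j \<le> Suc h" "?p i = 0" "?p j \<noteq> 0" for i j
  proof (cases "j = Suc h")
    case True
    then have "i \<le> h" "p i = 0" using ij by (auto simp: le_Suc_eq split: if_splits)
    moreover have "p h \<noteq> 0" using True ij(4) by (auto simp: pnext_def split: if_splits)
    ultimately show ?thesis using c4 by blast
  next
    case False
    then show ?thesis using ij c4[of i j] by auto
  qed
  moreover have "j \<le> S \<or> Suc h \<le> S + Suc k \<or>
        (\<exists>d<j. A d = 2 \<and> (\<forall>i\<le>d. A i \<noteq> 0) \<and> Suc h \<le> d + Suc k)"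
    if j: "j \<le> Suc h" "?p j = 0" for j
  proof (cases "j = Suc h")
    case False
    then have "j \<le> h" "p j = 0" using j by auto
    then show ?thesis using c5[of j] by auto
  next
    case True
    then have z: "pnext (p h) (A h) = 0" using j by simp
    show ?thesis
    proof (cases "p h = 0")
      case True
      then show ?thesis using c5[of h] \<open>j = Suc h\<close> by (metis add_Suc_right le_add1 less_SucI not_less_eq_eq order_refl le_trans)
    next
      case False
      \<comment> \<open>A fresh 0 arises only from mark 1 at a scanned 1-bit; that bit is the
        witness \<open>d = h\<close>, and mark 1 gives the blank-free prefix.\<close>
      then have "p h = 1" "A h = 2" using z ph(1) assms(2)[rule_format, of h]
        by (auto simp: pnext_def split: if_splits)
      then show ?thesis using ph(2) True by (intro disjI2 exI[of _ h]) (auto simp: pval_def le_less)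
    qed
  qed
  ultimately show ?thesis unfolding core_def by blast
qed

text \<open>The fourth clause at \<open>j = h\<close> puts every mark 0 up to the head at or below
  \<open>S\<close>, so the fifth holds by its first alternative.\<close>

lemma core_reset:
  assumes "core S k A s p e h" "p h \<noteq> 0"
  shows "core S 0 A s p e h"
  using assms unfolding core_def by blast

text \<open>A failed test leaves two cases. Under mark 0 the fifth clause applies, where a 1-bit at
  \<open>d\<close> forces \<open>d < S\<close>; under mark 1 the unbroken word has a 1-bit at or
  beyond the head, so the head itself is below the address.\<close>

lemma core_recompute_bound:
  assumes "core S k A s p e h" "\<exists>j. A j = 0" "\<forall>j. A j \<le> 2" "addr_of A < S"
    and n: "\<not> (p h = 2 \<or> (p h = 1 \<and> (A h = 0 \<or> (A h = 1 \<and> s h = 0))))"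
  shows "h \<le> S + k"
proof -
  note c = assms(1)[unfolded core_def]
  have ph: "p h \<le> 2" "pval A e h (p h)" "s h = of_bool (live A (Suc h))" using c by auto
  show ?thesis
  proof (cases "p h = 0")
    case True
    then have "h \<le> S \<or> h \<le> S + k \<or> (\<exists>d<h. A d = 2 \<and> (\<forall>i\<le>d. A i \<noteq> 0) \<and> h \<le> d + k)"
      using c by blast
    moreover have "d < S" if "A d = 2" "\<forall>i\<le>d. A i \<noteq> 0" for d
      using one_bit_less_addr_of[OF assms(2) that(2,1)] assms(4) by simp
    ultimately show ?thesis by fastforce
  next
    case False
    then have p1: "p h = 1" using n ph(1) by auto
    then have nb: "\<forall>i<h. A i \<noteq> 0" using ph(2) by (auto simp: pval_def)
    have "live A h" using n p1 ph(3) assms(3)[rule_format, of h] live_rec[of A h] by (auto split: if_splits)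
    then show ?thesis using live_less_addr_of[OF assms(2) nb] assms(4) by simp
  qed
qed

section \<open>The simulating machine\<close>

text \<open>\<open>Sim\<close> performs a transition, \<open>ArrL\<close>/\<open>ArrR\<close> update the track of the cell just entered from the
  right/left, \<open>Chk\<close> decides whether the address must be recomputed, and \<open>Op\<close> reads or writes tape 0. The remaining
  phases recompute the address: reset tape 0, walk to the left end while completing the suffix track, walk right to
  the highest 1-bit, one doubling (\<open>Dbl\<close>, \<open>Cpy\<close>) per bit on the way back to cell 0, and
  return to the old head position, marked by 3 on the prefix track, while rewriting that track.\<close>
datatype phase = Sim | ArrL nat | ArrR nat | Chk | Op | Rst | WalkL nat | WalkR
  | Dbl | Dbl2 | Cpy | Back nat

text \<open>\<open>Run\<close> carries the state, main memory and memory head of the simulated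
  machine. \<open>Start\<close> exists to write the left-end markers.\<close>

datatype astate = Start | Fin | Run phase nat "nat \<Rightarrow> nat" nat

text \<open>Tape 0 with its head \<open>ace\<close>, a unary counter \<open>acv\<close>, and the address tape with
  its suffix and prefix tracks under the common head \<open>ach\<close>.\<close>
datatype aconf = AC (acst: astate) (acX: "nat \<Rightarrow> nat") (ace: nat) (acv: nat)
  (acA: "nat \<Rightarrow> nat") (acs: "nat \<Rightarrow> nat") (acp: "nat \<Rightarrow> nat") (ach: nat)

locale tlm_sim =
  fixes M :: nat and P :: tlm
  assumes wf: "tl_wf M P"
begin

definition nxt :: "nat \<Rightarrow> phase" where
  "nxt q = (if q \<in> tl_R P \<union> tl_W P then Chk else Sim)"

text \<open>The result lists the new state, the symbol for tape 0, the moves on tape 0 and the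
  counter, the symbols for the address tape and its two tracks, and their common move. The Boolean
  inputs are left-end tests.\<close>

fun loc :: "astate \<Rightarrow> nat \<Rightarrow> bool \<Rightarrow> bool \<Rightarrow> nat \<Rightarrow> nat \<Rightarrow> nat \<Rightarrow> bool \<Rightarrow>
    astate \<times> nat \<times> dir \<times> dir \<times> nat \<times> nat \<times> nat \<times> dir" where
  "loc (Run Sim q m i) x e0 v0 a s p h0 =
     (case tl_delta P q (m i) a of (q', w, d, b, ad) \<Rightarrow>
        (if q' = tl_acc P then Fin
         else Run (case ad of Stay \<Rightarrow> nxt q' | Rgt \<Rightarrow> ArrR (pnext p b)
                   | Lft \<Rightarrow> if h0 then nxt q' else ArrL (lbit b s))
                q' (m(i := w)) (min (M - 1) (mv d i)),
         x, Stay, Stay, b, s, p, ad))"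
| "loc (Run (ArrL c) q m i) x e0 v0 a s p h0 = (Run (nxt q) q m i, x, Stay, Stay, a, c, p, Stay)"
| "loc (Run (ArrR r) q m i) x e0 v0 a s p h0 = (Run (nxt q) q m i, x, Stay, Stay, a, s, r, Stay)"
| "loc (Run Chk q m i) x e0 v0 a s p h0 =
     (if p = 2 \<or> (p = 1 \<and> (a = 0 \<or> (a = 1 \<and> s = 0)))
      then (Run Op q m i, x, Stay, Stay, a, s, p, Stay)
      else (Run Rst q m i, x, Stay, Stay, a, s, 3, Stay))"
| "loc (Run Op q m i) x e0 v0 a s p h0 =
     (Run Sim q (if q \<in> tl_R P then m(i := x) else m) i, if q \<in> tl_W P then m i else x,
      Stay, Stay, a, s, p, Stay)"
| "loc (Run Rst q m i) x e0 v0 a s p h0 =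
     (if e0 then (Run (WalkL s) q m i, x, Stay, Stay, a, s, p, Stay)
      else (Run Rst q m i, x, Lft, Stay, a, s, p, Stay))"
| "loc (Run (WalkL c) q m i) x e0 v0 a s p h0 =
     (if h0 then (Run WalkR q m i, x, Stay, Stay, a, c, p, Stay)
      else (Run (WalkL (lbit a c)) q m i, x, Stay, Stay, a, c, p, Lft))"
| "loc (Run WalkR q m i) x e0 v0 a s p h0 =
     (if a \<noteq> 0 \<and> s = 1 then (Run WalkR q m i, x, Stay, Stay, a, s, p, Rgt)
      else (Run Dbl q m i, x, Stay, Stay, a, s, p, Stay))"
| "loc (Run Dbl q m i) x e0 v0 a s p h0 =
     (if e0 then (Run Cpy q m i, x, Stay, if a = 2 then Rgt else Stay, a, s, p, Stay)
      else (Run Dbl2 q m i, x, Lft, Rgt, a, s, p, Stay))"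
| "loc (Run Dbl2 q m i) x e0 v0 a s p h0 = (Run Dbl q m i, x, Stay, Rgt, a, s, p, Stay)"
| "loc (Run Cpy q m i) x e0 v0 a s p h0 =
     (if v0 then (if h0 then (Run (Back 0) q m i, x, Stay, Stay, a, s, p, Stay)
                  else (Run Dbl q m i, x, Stay, Stay, a, s, p, Lft))
      else (Run Cpy q m i, x, Rgt, Lft, a, s, p, Stay))"
| "loc (Run (Back r) q m i) x e0 v0 a s p h0 =
     (if p = 3 then (Run Op q m i, x, Stay, Stay, a, s, r, Stay)
      else (Run (Back (if r = 0 then (if a \<noteq> 0 \<and> s = 1 then 0 else if a = 0 then 2 else 1)
                       else pnext r a)) q m i, x, Stay, Stay, a, s, r, Rgt))"
| "loc Fin x e0 v0 a s p h0 = (Fin, x, Stay, Stay, a, s, p, Stay)"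
| "loc Start x e0 v0 a s p h0 = (Start, x, Stay, Stay, a, s, p, Stay)"

fun astep :: "aconf \<Rightarrow> aconf" where
  "astep (AC z X e v A s p h) =
     (case loc z (X e) (e = 0) (v = 0) (A h) (s h) (p h) (h = 0) of
        (z', x', de, dv, a', s', p', da) \<Rightarrow>
          AC z' (X(e := x')) (mv de e) (mv dv v) (A(h := a')) (s(h := s')) (p(h := p')) (mv da h))"

section \<open>Running times of the single phases\<close>

definition reach :: "nat \<Rightarrow> aconf \<Rightarrow> aconf \<Rightarrow> bool" where
  "reach b c c' \<longleftrightarrow> (\<exists>n\<le>b. (astep ^^ n) c = c')"

lemma reach_refl: "reach b c c"
  unfolding reach_def by (intro exI[of _ 0]) simp

lemma reach_trans:
  assumes "reach b c c'" "reach b' c' c''"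
  shows "reach (b + b') c c''"
proof -
  obtain n n' where "n \<le> b" "(astep ^^ n) c = c'" "n' \<le> b'" "(astep ^^ n') c' = c''"
    using assms unfolding reach_def by blast
  then show ?thesis unfolding reach_def
    by (intro exI[of _ "n' + n"]) (simp add: funpow_add)
qed

lemma reach_mono: "reach b c c' \<Longrightarrow> b \<le> b' \<Longrightarrow> reach b' c c'"
  unfolding reach_def using order_trans by blast

lemma reach_step: "astep c = c' \<Longrightarrow> reach 1 c c'"
  unfolding reach_def by (intro exI[of _ 1]) simp

lemma reach_Suc: "reach b (astep c) c' \<Longrightarrow> reach (Suc b) c c'"
  using reach_trans[OF reach_step[OF refl]] by force

lemma reach_reset:
  "reach (Suc e) (AC (Run Rst q m i) X e v A s p h) (AC (Run (WalkL (s h)) q m i) X 0 v A s p h)"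
proof (induction e)
  case 0
  show ?case by (rule reach_mono[OF reach_step]) auto
next
  case (Suc e)
  show ?case by (rule reach_Suc) (use Suc in simp)
qed

text \<open>Left of the old head the suffix track may be stale. The carried \<open>c\<close> is the
  correct entry for the scanned cell, and \<open>lbit\<close> yields the next one.\<close>

lemma reach_walk_left:
  assumes "\<forall>j. A j \<le> 2" "c = of_bool (live A (Suc h))"
    "\<forall>j>h. s j = of_bool (live A (Suc j))"
  shows "reach (Suc h) (AC (Run (WalkL c) q m i) X e v A s p h)
    (AC (Run WalkR q m i) X e v A (\<lambda>j. of_bool (live A (Suc j))) p 0)"
  using assms(2,3)
proof (induction h arbitrary: c s)
  case 0
  have "s(0 := c) = (\<lambda>j. of_bool (live A (Suc j)))" using 0 by (auto simp: fun_eq_iff)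
  then show ?case by (intro reach_mono[OF reach_step]) auto
next
  case (Suc h)
  have "lbit (A (Suc h)) c = of_bool (live A (Suc h))" using Suc.prems assms(1) lbit_live by simp
  then have "reach (Suc h) (AC (Run (WalkL (lbit (A (Suc h)) c)) q m i) X e v A (s(Suc h := c)) p h)
    (AC (Run WalkR q m i) X e v A (\<lambda>j. of_bool (live A (Suc j))) p 0)"
    using Suc.prems by (intro Suc.IH) auto
  then show ?case by - (rule reach_Suc, simp)
qed

text \<open>Each advance enters a cell below the address, since a 1-bit lies there or further right;
  this bounds the steps. Where the walk stops, the prefix including that cell has the full
  value.\<close>

lemma reach_walk_right:
  assumes "\<forall>j. A j \<le> 2" "\<exists>j. A j = 0" "\<forall>i<j. A i \<noteq> 0" "j \<le> addr_of A"
    and s: "s = (\<lambda>j. of_bool (live A (Suc j)))"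
  shows "\<exists>h. h \<le> addr_of A \<and> psum A (Suc h) = addr_of A \<and>
    reach (Suc (addr_of A - j)) (AC (Run WalkR q m i) X e v A s p j)
      (AC (Run Dbl q m i) X e v A s p h)"
  using assms(3,4)
proof (induction "addr_of A - j" arbitrary: j rule: less_induct)
  case less
  show ?case
  proof (cases "A j \<noteq> 0 \<and> live A (Suc j)")
    case True
    have nb: "\<forall>i<Suc j. A i \<noteq> 0" using True less.prems by (auto simp: less_Suc_eq)
    have lt: "Suc j < addr_of A" using live_less_addr_of[OF assms(2) nb] True by blast
    then obtain h where h: "h \<le> addr_of A" "psum A (Suc h) = addr_of A"
      "reach (Suc (addr_of A - Suc j)) (AC (Run WalkR q m i) X e v A s p (Suc j))
         (AC (Run Dbl q m i) X e v A s p h)"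
      using less.hyps[of "Suc j"] nb by (meson diff_less_mono2 lessI less_imp_le Suc_lessD)
    have "reach (Suc (Suc (addr_of A - Suc j))) (AC (Run WalkR q m i) X e v A s p j)
         (AC (Run Dbl q m i) X e v A s p h)"
      using h(3) True s by - (rule reach_Suc, simp add: fun_upd_idem)
    then show ?thesis using h lt by (metis Suc_diff_Suc Suc_lessD)
  next
    case False
    have "psum A (Suc j) = addr_of A"
    proof (cases "A j = 0")
      case True
      then show ?thesis using addr_of_eq_psum[of j A] less.prems by (simp add: psum_Suc)
    next
      case nz: False
      then have "\<forall>i<Suc j. A i \<noteq> 0" using less.prems by (auto simp: less_Suc_eq)
      then show ?thesis using addr_of_not_live[OF assms(2)] assms(1) False nz by metis
    qed
    moreover have "reach (Suc (addr_of A - j)) (AC (Run WalkR q m i) X e v A s p j)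
         (AC (Run Dbl q m i) X e v A s p j)"
      using False s by (intro reach_mono[OF reach_step]) auto
    ultimately show ?thesis using less.prems by blast
  qed
qed

lemma reach_double:
  "reach (Suc (2 * e)) (AC (Run Dbl q m i) X e v A s p h)
     (AC (Run Cpy q m i) X 0 (v + 2 * e + of_bool (A h = 2)) A s p h)"
proof (induction e arbitrary: v)
  case 0
  show ?case by (rule reach_mono[OF reach_step]) auto
next
  case (Suc e)
  have "reach 1 (AC (Run Dbl q m i) X (Suc e) v A s p h) (AC (Run Dbl2 q m i) X e (Suc v) A s p h)"
    by (rule reach_step) simp
  moreover have "reach 1 (AC (Run Dbl2 q m i) X e (Suc v) A s p h)
      (AC (Run Dbl q m i) X e (Suc (Suc v)) A s p h)"
    by (rule reach_step) simp
  ultimately show ?case using reach_trans[OF _ reach_trans[OF _ Suc[of "Suc (Suc v)"]]] by fastforce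
qed

lemma reach_copy:
  "reach v (AC (Run Cpy q m i) X e v A s p h) (AC (Run Cpy q m i) X (e + v) 0 A s p h)"
proof (induction v arbitrary: e)
  case 0
  show ?case using reach_refl by simp
next
  case (Suc v)
  show ?case by (rule reach_Suc) (use Suc[of "Suc e"] in simp)
qed

text \<open>Invariant of Horner's scheme: \<open>psum A (Suc h) + 2 ^ Suc h * e\<close> does not change.\<close>
lemma reach_horner:
  assumes "\<forall>j. A j \<le> 2"
  shows "\<exists>b. b + 4 * e \<le> 4 * (psum A (Suc h) + 2 ^ Suc h * e) + 3 * Suc h \<and>
    reach b (AC (Run Dbl q m i) X e 0 A s p h)
      (AC (Run (Back 0) q m i) X (psum A (Suc h) + 2 ^ Suc h * e) 0 A s p 0)"
proof (induction h arbitrary: e)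
  case 0
  let ?e = "2 * e + of_bool (A 0 = 2)"
  have e: "?e = psum A (Suc 0) + 2 ^ Suc 0 * e"
    using assms[rule_format, of 0] by (auto simp: psum_def)
  \<comment> \<open>A round costs \<open>2 * e + 1\<close> steps for doubling, \<open>?e\<close> for
    copying and 1 for the turn. As \<open>2 * e\<close> \<le> \<open>?e\<close>, cost plus
    \<open>4 * e\<close> is at most \<open>4 * ?e + 2\<close>: the potential pays for all but a
    constant per bit.\<close>
  have "reach (Suc (2 * e) + ?e + 1) (AC (Run Dbl q m i) X e 0 A s p 0)
      (AC (Run (Back 0) q m i) X ?e 0 A s p 0)"
  proof (rule reach_trans[OF reach_trans])
    show "reach (Suc (2 * e)) (AC (Run Dbl q m i) X e 0 A s p 0) (AC (Run Cpy q m i) X 0 ?e A s p 0)"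
      using reach_double[of e q m i X 0] by simp
    show "reach ?e (AC (Run Cpy q m i) X 0 ?e A s p 0) (AC (Run Cpy q m i) X ?e 0 A s p 0)"
      using reach_copy[of ?e q m i X 0] by simp
  qed (rule reach_step, simp)
  then show ?case unfolding e[symmetric] by (intro exI[of _ "Suc (2 * e) + ?e + 1"]) auto
next
  case (Suc h)
  let ?e = "2 * e + of_bool (A (Suc h) = 2)"
  have e: "psum A (Suc h) + 2 ^ Suc h * ?e = psum A (Suc (Suc h)) + 2 ^ Suc (Suc h) * e"
    using assms[rule_format, of "Suc h"] by (auto simp: psum_Suc[of A "Suc h"] algebra_simps)
  obtain b where b: "b + 4 * ?e \<le> 4 * (psum A (Suc h) + 2 ^ Suc h * ?e) + 3 * Suc h"
    "reach b (AC (Run Dbl q m i) X ?e 0 A s p h)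
      (AC (Run (Back 0) q m i) X (psum A (Suc h) + 2 ^ Suc h * ?e) 0 A s p 0)"
    using Suc.IH[of ?e] by blast
  have "reach (Suc (2 * e) + ?e + 1) (AC (Run Dbl q m i) X e 0 A s p (Suc h))
      (AC (Run Dbl q m i) X ?e 0 A s p h)"
  proof (rule reach_trans[OF reach_trans])
    show "reach (Suc (2 * e)) (AC (Run Dbl q m i) X e 0 A s p (Suc h)) (AC (Run Cpy q m i) X 0 ?e A s p (Suc h))"
      using reach_double[of e q m i X 0] by simp
    show "reach ?e (AC (Run Cpy q m i) X 0 ?e A s p (Suc h)) (AC (Run Cpy q m i) X ?e 0 A s p (Suc h))"
      using reach_copy[of ?e q m i X 0] by simp
  qed (rule reach_step, simp)
  from reach_trans[OF this b(2)] show ?case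
    unfolding e using b(1) unfolding e
    by (intro exI[of _ "Suc (2 * e) + ?e + 1 + b"] conjI) auto
qed

text \<open>Here \<open>r\<close> is the mark due at the scanned cell. It starts at 0 and stays 0
  while 1-bits lie ahead, so marks 0 occur only up to the address; afterwards the prefix has the
  full value.\<close>

lemma reach_back:
  assumes "\<forall>j. A j \<le> 2" "\<exists>j. A j = 0" "e = addr_of A"
    and s: "s = (\<lambda>j. of_bool (live A (Suc j)))"
    and "p h = 3" "\<forall>j. j \<noteq> h \<longrightarrow> p j \<le> 2" "j \<le> h"
    and "pval A e j r" "r \<le> 2" "r = 0 \<longrightarrow> (\<forall>i<j. A i \<noteq> 0) \<and> j \<le> e"
    and "\<forall>i<j. pval A e i (p i) \<and> (p i = 0 \<longrightarrow> i \<le> e)"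
  shows "\<exists>p'. (\<forall>j. p' j \<le> 2) \<and> (\<forall>j\<le>h. pval A e j (p' j) \<and> (p' j = 0 \<longrightarrow> j \<le> e)) \<and>
    reach (Suc (h - j)) (AC (Run (Back r) q m i) X x v A s p j) (AC (Run Op q m i) X x v A s p' h)"
  using assms(5-)
proof (induction "h - j" arbitrary: j r p)
  case 0
  then have j: "j = h" by simp
  have "(p(h := r)) j \<le> 2" for j using 0 by simp
  moreover have "\<forall>j\<le>h. pval A e j ((p(h := r)) j) \<and> ((p(h := r)) j = 0 \<longrightarrow> j \<le> e)"
    using 0 j by auto
  moreover have "reach (Suc (h - j)) (AC (Run (Back r) q m i) X x v A s p j)
      (AC (Run Op q m i) X x v A s (p(h := r)) h)"
    using 0 j by (intro reach_mono[OF reach_step]) auto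
  ultimately show ?case by blast
next
  case (Suc n)
  then have jh: "j < h" by simp
  let ?r = "if r = 0 then (if A j \<noteq> 0 \<and> s j = 1 then 0 else if A j = 0 then 2 else 1)
            else pnext r (A j)"
  have sj: "s j = 1 \<longleftrightarrow> live A (Suc j)" using s by simp
  have pv: "pval A e (Suc j) ?r"
  proof (cases "r = 0")
    case True
    then have nb: "\<forall>i<j. A i \<noteq> 0" using Suc.prems by simp
    show ?thesis
    proof (cases "A j = 0")
      case True
      then show ?thesis using \<open>r = 0\<close> assms(3) by (auto simp: pval_def)
    next
      case False
      then have "\<forall>i<Suc j. A i \<noteq> 0" using nb by (auto simp: less_Suc_eq)
      then show ?thesis using addr_of_not_live[OF assms(2), of "Suc j"] False \<open>r = 0\<close> assms(1,3) sj
        by (auto simp: pval_def)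
    qed
  next
    case False
    then show ?thesis using pval_next Suc.prems by simp
  qed
  \<comment> \<open>Mark 0 at the next cell implies a 1-bit at \<open>j\<close> or later in the
    word, so the address exceeds \<open>j\<close>.\<close>
  have z: "(\<forall>i<Suc j. A i \<noteq> 0) \<and> Suc j \<le> e" if r0: "?r = 0"
  proof -
    have "(r = 0 \<and> A j \<noteq> 0 \<and> live A (Suc j)) \<or> (r = 1 \<and> A j = 2)"
      using r0 sj Suc.prems(5) assms(1)[rule_format, of j] by (auto simp: pnext_def split: if_splits)
    then show ?thesis
    proof
      assume a: "r = 0 \<and> A j \<noteq> 0 \<and> live A (Suc j)"
      then have "\<forall>i<Suc j. A i \<noteq> 0" using Suc.prems by (auto simp: less_Suc_eq)
      then show ?thesis using live_less_addr_of[OF assms(2), of "Suc j"] a assms(3) by simp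
    next
      assume a: "r = 1 \<and> A j = 2"
      then have "\<forall>i<j. A i \<noteq> 0" using Suc.prems(4) by (simp add: pval_def)
      then have nb: "\<forall>i<Suc j. A i \<noteq> 0" using a by (auto simp: less_Suc_eq)
      then show ?thesis using one_bit_less_addr_of[OF assms(2), of j] a assms(3)
        by (simp add: less_Suc_eq_le)
    qed
  qed
  have "\<exists>p'. (\<forall>j. p' j \<le> 2) \<and> (\<forall>j\<le>h. pval A e j (p' j) \<and> (p' j = 0 \<longrightarrow> j \<le> e)) \<and>
    reach (Suc (h - Suc j)) (AC (Run (Back ?r) q m i) X x v A s (p(j := r)) (Suc j))
      (AC (Run Op q m i) X x v A s p' h)"
  proof (rule Suc.hyps(1))
    show "n = h - Suc j" using Suc.hyps(2) by simp
    show "(p(j := r)) h = 3" "Suc j \<le> h" using Suc.prems jh by auto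
    show "\<forall>i. i \<noteq> h \<longrightarrow> (p(j := r)) i \<le> 2" using Suc.prems by simp
    show "?r \<le> 2" by (auto simp: pnext_def)
    show "\<forall>i<Suc j. pval A e i ((p(j := r)) i) \<and> ((p(j := r)) i = 0 \<longrightarrow> i \<le> e)"
      using Suc.prems by (auto simp: less_Suc_eq)
  qed (use pv z in blast)+
  then obtain p' where p': "\<forall>j. p' j \<le> 2"
    "\<forall>j\<le>h. pval A e j (p' j) \<and> (p' j = 0 \<longrightarrow> j \<le> e)"
    "reach (Suc (h - Suc j)) (AC (Run (Back ?r) q m i) X x v A s (p(j := r)) (Suc j))
      (AC (Run Op q m i) X x v A s p' h)" by blast
  have "p j \<noteq> 3" using Suc.prems(2)[rule_format, of j] jh by auto
  then have "reach (Suc (Suc (h - Suc j))) (AC (Run (Back r) q m i) X x v A s p j)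
      (AC (Run Op q m i) X x v A s p' h)"
    using p'(3) by - (rule reach_Suc, simp)
  then show ?case using p'(1,2) jh by (metis Suc_diff_Suc)
qed

lemma reach_io_address:
  assumes c: "core S k A s p e h" and A: "\<forall>j. A j \<le> 2" "\<exists>j. A j = 0" and S: "addr_of A < S" "e \<le> S"
  shows "\<exists>s' p'. core S 0 A s' p' (addr_of A) h \<and>
    reach (15 * (1 + k + S)) (AC (Run Chk q m i) X e 0 A s p h)
      (AC (Run Op q m i) X (addr_of A) 0 A s' p' h)"
proof (cases "p h = 2 \<or> (p h = 1 \<and> (A h = 0 \<or> (A h = 1 \<and> s h = 0)))")
  case True
  have "pval A e h (p h)" "s h = of_bool (live A (Suc h))" using c by (auto simp: core_def)
  then have e: "addr_of A = e" using True pval_clean[of A e h "p h"] A by auto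
  have "core S 0 A s p e h" using True core_reset[OF c] by auto
  moreover have "reach (15 * (1 + k + S)) (AC (Run Chk q m i) X e 0 A s p h)
      (AC (Run Op q m i) X e 0 A s p h)"
    using True by (intro reach_mono[OF reach_step]) auto
  ultimately show ?thesis unfolding e by blast
next
  case False
  let ?s = "\<lambda>j. of_bool (live A (Suc j))" and ?p = "p(h := 3)" and ?a = "addr_of A"
  have h: "h \<le> S + k" using core_recompute_bound[OF c A(2,1) S(1) False] .
  have r1: "reach 1 (AC (Run Chk q m i) X e 0 A s p h) (AC (Run Rst q m i) X e 0 A s ?p h)"
    using False by (intro reach_step) auto
  have r2: "reach (Suc e) (AC (Run Rst q m i) X e 0 A s ?p h)
     (AC (Run (WalkL (s h)) q m i) X 0 0 A s ?p h)" by (rule reach_reset)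
  have r3: "reach (Suc h) (AC (Run (WalkL (s h)) q m i) X 0 0 A s ?p h)
     (AC (Run WalkR q m i) X 0 0 A ?s ?p 0)"
    using c by (intro reach_walk_left A) (auto simp: core_def)
  obtain g where g: "g \<le> ?a" "psum A (Suc g) = ?a" and
    r4: "reach (Suc (?a - 0)) (AC (Run WalkR q m i) X 0 0 A ?s ?p 0)
      (AC (Run Dbl q m i) X 0 0 A ?s ?p g)"
    using reach_walk_right[OF A, of 0 ?s] by blast
  obtain b where b: "b \<le> 4 * ?a + 3 * Suc g" and
    r5: "reach b (AC (Run Dbl q m i) X 0 0 A ?s ?p g) (AC (Run (Back 0) q m i) X ?a 0 A ?s ?p 0)"
    using reach_horner[OF A(1), of 0 g q m i X ?s ?p] g(2) by auto
  obtain p' where p': "\<forall>j. p' j \<le> 2" "\<forall>j\<le>h. pval A ?a j (p' j) \<and> (p' j = 0 \<longrightarrow> j \<le> ?a)" and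
    r6: "reach (Suc (h - 0)) (AC (Run (Back 0) q m i) X ?a 0 A ?s ?p 0)
      (AC (Run Op q m i) X ?a 0 A ?s p' h)"
    using reach_back[OF A refl refl, of ?p h 0 0 q m i X ?a 0] c by (auto simp: core_def pval_def)
  \<comment> \<open>Marks 0 occur only up to \<open>?a < S\<close>, so the last two clauses hold
    through their bounds by \<open>S\<close>.\<close>
  have "core S 0 A ?s p' ?a h" unfolding core_def using p' S(1) by (meson le_trans less_imp_le)
  moreover have "reach (15 * (1 + k + S)) (AC (Run Chk q m i) X e 0 A s p h)
      (AC (Run Op q m i) X ?a 0 A ?s p' h)"
    \<comment> \<open>Every phase is linear in \<open>e\<close>, \<open>h\<close> or
      \<open>?a\<close>, all at most \<open>S + k\<close>; 15 is a generous common factor.\<close>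
    using reach_trans[OF r1 reach_trans[OF r2 reach_trans[OF r3 reach_trans[OF r4 reach_trans[OF r5 r6]]]]]
    by (rule reach_mono) (use h S g b in simp)
  ultimately show ?thesis by blast
qed

end

section \<open>Counting steps\<close>

lemma tl_io_Suc: "tl_io M P x (Suc n) = tl_io M P x n + of_bool (tl_is_io M P x n)"
proof -
  have "{i. i < Suc n \<and> tl_is_io M P x i} =
      (if tl_is_io M P x n then insert n {i. i < n \<and> tl_is_io M P x i} else {i. i < n \<and> tl_is_io M P x i})"
    by (auto simp: less_Suc_eq)
  then show ?thesis by (simp add: tl_io_def)
qed

lemma tl_run_Suc: "tl_run M P x (Suc n) = tl_step M P (tl_run M P x n)"
  by (simp add: tl_run_def)

lemma tl_run_stable:
  assumes "cst (tl_run M P x n) = tl_acc P" "n \<le> n'"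
  shows "tl_run M P x n' = tl_run M P x n"
  using assms(2)
proof (induction rule: dec_induct)
  case (step m)
  then show ?case using assms(1) by (simp add: tl_run_def tl_step_def)
qed simp

lemma tl_time_plus_io: "tl_time M P x n + tl_io M P x n = n"
proof -
  have "{i. i < n} = {i. i < n \<and> \<not> tl_is_io M P x i} \<union> {i. i < n \<and> tl_is_io M P x i}" by blast
  then have "card {i. i < n} = tl_time M P x n + tl_io M P x n" unfolding tl_time_def tl_io_def
    by (metis (no_types, lifting) card_Un_disjoint disjoint_iff finite_Collect_less_nat finite_Un mem_Collect_eq)
  then show ?thesis by simp
qed

text \<open>Allows a bare IO count to be absorbed into IO times space.\<close>

lemma tl_space_pos: "0 < tl_io M P x n \<Longrightarrow> 0 < tl_space M P x n"
  by (auto simp: tl_space_def tl_io_def card_gt_0_iff)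

section \<open>The simulation\<close>

context tlm_sim
begin

section \<open>The finitely many states and symbols in use\<close>

fun gphase :: "phase \<Rightarrow> bool" where
  "gphase (ArrL c) = (c \<le> 1)"
| "gphase (ArrR r) = (r \<le> 2)"
| "gphase (WalkL c) = (c \<le> 1)"
| "gphase (Back r) = (r \<le> 2)"
| "gphase _ = True"

text \<open>Fixing the memory to 0 outside its \<open>M\<close> cells leaves finitely many
  functions. The accepting state is excluded because entering it becomes \<open>Fin\<close>.\<close>

fun gstate :: "astate \<Rightarrow> bool" where
  "gstate (Run ph q m i) \<longleftrightarrow> gphase ph \<and> q \<in> tl_Q P - {tl_acc P} \<and>
     (\<forall>j. (j \<in> {..<M} \<longrightarrow> m j \<in> tl_G P) \<and> (j \<notin> {..<M} \<longrightarrow> m j = 0)) \<and> i < M"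
| "gstate _ = True"

fun gconf :: "aconf \<Rightarrow> bool" where
  "gconf (AC z X e v A s p h) \<longleftrightarrow> gstate z \<and> z \<noteq> Start \<and> (\<forall>j. X j \<in> tl_G P) \<and>
     (\<forall>j. A j \<le> 2) \<and> (\<forall>j. s j \<le> 1) \<and> (\<forall>j. p j \<le> 3)"

lemma finite_gphase: "finite {ph. gphase ph}"
proof -
  have "{ph. gphase ph} \<subseteq> {Sim, Chk, Op, Rst, WalkR, Dbl, Dbl2, Cpy} \<union>
      (ArrL ` {..1} \<union> ArrR ` {..2} \<union> WalkL ` {..1} \<union> Back ` {..2})"
  proof
    fix ph assume "ph \<in> {ph. gphase ph}"
    then show "ph \<in> {Sim, Chk, Op, Rst, WalkR, Dbl, Dbl2, Cpy} \<union>
      (ArrL ` {..1} \<union> ArrR ` {..2} \<union> WalkL ` {..1} \<union> Back ` {..2})" by (cases ph) auto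
  qed
  then show ?thesis by (rule finite_subset) simp
qed

lemma finite_gstate: "finite {z. gstate z}"
proof -
  let ?F = "{m. \<forall>j. (j \<in> {..<M} \<longrightarrow> m j \<in> tl_G P) \<and> (j \<notin> {..<M} \<longrightarrow> m j = (0::nat))}"
  have "{z. gstate z} \<subseteq> {Start, Fin} \<union>
     (\<lambda>(ph, q, m, i). Run ph q m i) ` ({ph. gphase ph} \<times> (tl_Q P - {tl_acc P}) \<times> ?F \<times> {..<M})"
  proof
    fix z assume "z \<in> {z. gstate z}"
    then show "z \<in> {Start, Fin} \<union>
     (\<lambda>(ph, q, m, i). Run ph q m i) ` ({ph. gphase ph} \<times> (tl_Q P - {tl_acc P}) \<times> ?F \<times> {..<M})"
      by (cases z) (auto simp: image_iff)
  qed
  moreover have "finite ?F" using wf by (intro finite_set_of_finite_funs) (auto simp: tl_wf_def)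
  moreover have "finite (tl_Q P)" using wf by (simp add: tl_wf_def)
  ultimately show ?thesis using finite_gphase
    by (elim finite_subset) (intro finite_UnI finite_imageI finite_cartesian_product finite_Diff; simp)
qed

lemma gphase_nxt: "gphase (nxt q)"
  by (simp add: nxt_def)

lemma tl_delta_wf:
  assumes "q \<in> tl_Q P - {tl_acc P}" "x \<in> tl_G P" "a \<le> 2" "tl_delta P q x a = (q', w, d, b, ad)"
  shows "q' \<in> tl_Q P" "w \<in> tl_G P" "b \<le> 2"
proof -
  have a: "a \<in> {0, 1, 2}" using assms(3) by auto
  have "\<forall>q \<in> tl_Q P - {tl_acc P}. \<forall>a \<in> tl_G P. \<forall>b \<in> {0,1,2}.
        (case tl_delta P q a b of (q', w, d, aw, ad) \<Rightarrow>
          q' \<in> tl_Q P \<and> w \<in> tl_G P \<and> aw \<in> {0,1,2})"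
    using wf unfolding tl_wf_def by (elim conjE)
  from bspec[OF bspec[OF bspec[OF this assms(1)] assms(2)] a]
  have "case tl_delta P q x a of (q', w, d, aw, ad) \<Rightarrow>
          q' \<in> tl_Q P \<and> w \<in> tl_G P \<and> aw \<in> {0,1,2}" .
  then show "q' \<in> tl_Q P" "w \<in> tl_G P" "b \<le> 2" using assms(4) by auto
qed

lemma pnext_le: "pnext r a \<le> 2"
  by (simp add: pnext_def)

lemma lbit_le: "lbit a s \<le> 1"
  by (simp add: lbit_def)

lemma loc_good:
  assumes "gstate z" "z \<noteq> Start" "x \<in> tl_G P" "a \<le> 2" "s \<le> 1" "p \<le> 3"
    and "loc z x e0 v0 a s p h0 = (z', x', de, dv, a', s', p', da)"
  shows "gstate z' \<and> z' \<noteq> Start \<and> x' \<in> tl_G P \<and> a' \<le> 2 \<and> s' \<le> 1 \<and> p' \<le> 3"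
proof (cases z)
  case (Run ph q m i)
  show ?thesis
  proof (cases ph)
    case Sim
    obtain q1 w d b ad where dl: "tl_delta P q (m i) a = (q1, w, d, b, ad)" by (metis prod.exhaust)
    have i: "i < M" "m i \<in> tl_G P" "q \<in> tl_Q P - {tl_acc P}" using assms(1) Run by auto
    have "min (M - 1) (mv d i) < M" using i(1) by simp
    then show ?thesis using assms Run Sim tl_delta_wf[OF i(3,2) assms(4) dl] dl i gphase_nxt pnext_le lbit_le
      by (auto split: dir.splits if_splits)
  next
    case (Back r)
    then show ?thesis using assms Run pnext_le by (auto split: if_splits)
  next
    case (WalkL r)
    then show ?thesis using assms Run lbit_le by (auto split: if_splits)
  qed (use assms Run gphase_nxt in \<open>auto split: if_splits\<close>)
qed (use assms in auto)

lemma astep_good: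
  assumes "gconf c"
  shows "gconf (astep c)"
proof (cases c)
  case (AC z X e v A s p h)
  obtain z' x' de dv a' s' p' da
    where l: "loc z (X e) (e = 0) (v = 0) (A h) (s h) (p h) (h = 0) = (z', x', de, dv, a', s', p', da)"
    by (metis prod.exhaust)
  have "gstate z' \<and> z' \<noteq> Start \<and> x' \<in> tl_G P \<and> a' \<le> 2 \<and> s' \<le> 1 \<and> p' \<le> 3"
    using loc_good[OF _ _ _ _ _ _ l] assms AC by simp
  then show ?thesis using assms AC l by simp
qed

lemma reach_good: "reach b c c' \<Longrightarrow> gconf c \<Longrightarrow> gconf c'"
proof -
  have "gconf c \<Longrightarrow> gconf ((astep ^^ n) c)" for n by (induction n) (auto simp: astep_good)
  then show "reach b c c' \<Longrightarrow> gconf c \<Longrightarrow> gconf c'" unfolding reach_def by blast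
qed

section \<open>Simulation invariant and amortised step count\<close>

text \<open>Holds between simulated transitions. Finiteness supplies the blank that terminates the
  address word.\<close>

definition siminv :: "nat \<Rightarrow> nat \<Rightarrow> tl_conf \<Rightarrow> aconf \<Rightarrow> bool" where
  "siminv S k t c \<longleftrightarrow> gconf c \<and> finite {j. atape t j \<noteq> 0} \<and>
     (\<exists>e s p. e \<le> S \<and> core S k (atape t) s p e (ah t) \<and>
        c = AC (Run Sim (cst t) (mem t) (mh t)) (ext t) e 0 (atape t) s p (ah t))"

text \<open>One step performs the transition, a second updates the track entry of the cell entered.
  A Read/Write is left to \<open>nxt\<close>.\<close>

lemma reach_arrive:
  assumes c: "core S k A s p e h"
    and g: "gconf (AC (Run Sim q m i) X e 0 A s p h)"
    and d: "tl_delta P q (m i) (A h) = (q', w, d, b, ad)" and q': "q' \<noteq> tl_acc P"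
  shows "\<exists>s' p'. core S (Suc k) (A(h := b)) s' p' e (mv ad h) \<and>
    reach 2 (AC (Run Sim q m i) X e 0 A s p h)
      (AC (Run (nxt q') q' (m(i := w)) (min (M - 1) (mv d i))) X e 0 (A(h := b)) s' p' (mv ad h))"
proof -
  let ?A = "A(h := b)" and ?z = "\<lambda>ph. Run ph q' (m(i := w)) (min (M - 1) (mv d i))"
  let ?c = "AC (Run Sim q m i) X e 0 A s p h"
  \<comment> \<open>Well-formedness of the successor bounds the address symbol \<open>b\<close> just
    written.\<close>
  have "gconf (astep ?c)" by (rule astep_good[OF g])
  then have A: "\<forall>j. ?A j \<le> 2" using d by simp
  have w: "core S k ?A s p e h" by (rule core_write[OF c])
  show ?thesis
  proof (cases "ad = Rgt")
    case True
    have "reach 1 ?c (AC (?z (ArrR (pnext (p h) b))) X e 0 ?A s p (Suc h))"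
      by (rule reach_step) (simp add: d q' True)
    moreover have "reach 1 (AC (?z (ArrR (pnext (p h) b))) X e 0 ?A s p (Suc h))
      (AC (?z (nxt q')) X e 0 ?A s (p(Suc h := pnext (p h) b)) (Suc h))"
      by (rule reach_step) (simp add: fun_upd_idem)
    ultimately have "reach (1 + 1) ?c (AC (?z (nxt q')) X e 0 ?A s (p(Suc h := pnext (p h) b)) (Suc h))"
      by (rule reach_trans)
    moreover have "core S (Suc k) ?A s (p(Suc h := pnext (p h) b)) e (Suc h)"
      using core_right[of S k ?A s p e h] w A by simp
    ultimately show ?thesis using True by (auto simp: numeral_2_eq_2)
  next
    case nr: False
    show ?thesis
    proof (cases "ad = Lft \<and> h \<noteq> 0")
      case True
      then obtain g where h: "h = Suc g" using not0_implies_Suc by blast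
      have "reach 1 ?c (AC (?z (ArrL (lbit b (s h)))) X e 0 ?A s p g)"
        by (rule reach_step) (simp add: d[unfolded h] q' True h)
      moreover have "reach 1 (AC (?z (ArrL (lbit b (s h)))) X e 0 ?A s p g)
        (AC (?z (nxt q')) X e 0 ?A (s(g := lbit b (s h))) p g)"
        by (rule reach_step) (simp add: fun_upd_idem)
      ultimately have "reach (1 + 1) ?c (AC (?z (nxt q')) X e 0 ?A (s(g := lbit b (s h))) p g)"
        by (rule reach_trans)
      moreover have "core S k ?A (s(g := lbit b (s h))) p e g"
        using core_left[of S k ?A s p e g] w A h by simp
      then have "core S (Suc k) ?A (s(g := lbit b (s h))) p e g" by (rule core_mono) simp
      ultimately show ?thesis using True h by (auto simp: numeral_2_eq_2)
    next
      case False
      then have mv: "mv ad h = h" using nr by (cases ad) auto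
      have "reach 1 ?c (AC (?z (nxt q')) X e 0 ?A s p h)"
        using False nr d q' by (intro reach_step) (cases ad; auto)
      then have "reach 2 ?c (AC (?z (nxt q')) X e 0 ?A s p h)" by (rule reach_mono) simp
      moreover have "core S (Suc k) ?A s p e h" using w by (rule core_mono) simp
      ultimately show ?thesis unfolding mv by blast
    qed
  qed
qed

lemma sim_step:
  assumes inv: "siminv S k t c" and t': "t' = tl_step M P t"
    and acc: "cst t' \<noteq> tl_acc P"
    and io: "io \<longleftrightarrow> cst t' \<in> tl_R P \<union> tl_W P" "io \<Longrightarrow> addr_of (atape t') < S"
  shows "\<exists>c'. reach (if io then 40 * (1 + k + S) else 2) c c' \<and>
    siminv S (if io then 0 else Suc k) t' c'"
proof -
  obtain e s p where e: "e \<le> S" and core: "core S k (atape t) s p e (ah t)" and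
    c: "c = AC (Run Sim (cst t) (mem t) (mh t)) (ext t) e 0 (atape t) s p (ah t)"
    and g: "gconf c" and fin: "finite {j. atape t j \<noteq> 0}"
    using inv unfolding siminv_def by blast
  obtain q' w d b ad where dl: "tl_delta P (cst t) (mem t (mh t)) (atape t (ah t)) = (q', w, d, b, ad)"
    by (metis prod.exhaust)
  let ?m = "(mem t)(mh t := w)" and ?i = "min (M - 1) (mv d (mh t))" and ?A = "(atape t)(ah t := b)"
  have na: "cst t \<noteq> tl_acc P" using g c by auto
  have t: "cst t' = q'" "mh t' = ?i" "atape t' = ?A" "ah t' = mv ad (ah t)"
    "mem t' = (if q' \<in> tl_R P then ?m(?i := ext t (addr_of ?A)) else ?m)"
    "ext t' = (if q' \<in> tl_W P then (ext t)(addr_of ?A := ?m ?i) else ext t)"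
    using na by (auto simp: t' tl_step_def dl Let_def)
  have fin': "finite {j. ?A j \<noteq> 0}"
    by (rule finite_subset[of _ "insert (ah t) {j. atape t j \<noteq> 0}"]) (use fin in auto)
  then have bl: "\<exists>j. ?A j = 0" using ex_new_if_finite[OF infinite_UNIV_nat] by fastforce
  obtain s' p' where core': "core S (Suc k) ?A s' p' e (ah t')" and
    r: "reach 2 c (AC (Run (nxt q') q' ?m ?i) (ext t) e 0 ?A s' p' (ah t'))"
    using reach_arrive[OF core g[unfolded c] dl] acc t c by auto
  have g': "gconf (AC (Run (nxt q') q' ?m ?i) (ext t) e 0 ?A s' p' (ah t'))"
    using reach_good[OF r g] .
  show ?thesis
  proof (cases io)
    case False
    then have "q' \<notin> tl_R P" "q' \<notin> tl_W P" using io t by auto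
    then show ?thesis using False r g' core' e fin' unfolding siminv_def
      by (intro exI[of _ "AC (Run (nxt q') q' ?m ?i) (ext t) e 0 ?A s' p' (ah t')"])
         (auto simp: t nxt_def simp del: fun_upd_apply)
  next
    case True
    let ?a = "addr_of ?A"
    have nx: "nxt q' = Chk" using True io t by (simp add: nxt_def)
    have A: "\<forall>j. ?A j \<le> 2" using g' by simp
    have a: "?a < S" using io(2) True t by simp
    obtain s2 p2 where core2: "core S 0 ?A s2 p2 ?a (ah t')" and
      r2: "reach (15 * (1 + Suc k + S)) (AC (Run Chk q' ?m ?i) (ext t) e 0 ?A s' p' (ah t'))
        (AC (Run Op q' ?m ?i) (ext t) ?a 0 ?A s2 p2 (ah t'))"
      using reach_io_address[OF core' A bl a e] by blast
    let ?c = "AC (Run Sim q' (mem t') ?i) (ext t') ?a 0 ?A s2 p2 (ah t')"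
    have r3: "reach 1 (AC (Run Op q' ?m ?i) (ext t) ?a 0 ?A s2 p2 (ah t')) ?c"
      by (rule reach_step) (simp add: t del: fun_upd_apply)
    have "reach (2 + (15 * (1 + Suc k + S) + 1)) c ?c"
      using reach_trans[OF r[unfolded nx] reach_trans[OF r2 r3]] .
    then have r4: "reach (40 * (1 + k + S)) c ?c" by (rule reach_mono) simp
    moreover have "siminv S 0 t' ?c" unfolding siminv_def
      using reach_good[OF r4 g] fin' core2 a t by (intro conjI exI[of _ ?a] exI[of _ s2] exI[of _ p2]) auto
    ultimately show ?thesis using True by auto
  qed
qed

text \<open>The accepting state is not a write state, so the last transition leaves the external
  memory unchanged.\<close>

lemma sim_last_step:
  assumes inv: "siminv S k t c" and t': "t' = tl_step M P t" and acc: "cst t' = tl_acc P"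
  shows "acst (astep c) = Fin \<and> acX (astep c) = ext t'"
proof -
  obtain e s p where
    c: "c = AC (Run Sim (cst t) (mem t) (mh t)) (ext t) e 0 (atape t) s p (ah t)" and g: "gconf c"
    using inv unfolding siminv_def by blast
  obtain q' w d b ad where dl: "tl_delta P (cst t) (mem t (mh t)) (atape t (ah t)) = (q', w, d, b, ad)"
    by (metis prod.exhaust)
  have na: "cst t \<noteq> tl_acc P" using g c by auto
  have q': "q' = tl_acc P" using acc na by (simp add: t' tl_step_def dl Let_def)
  moreover have "tl_acc P \<notin> tl_W P" using wf by (simp add: tl_wf_def)
  ultimately show ?thesis using na by (simp add: c t' tl_step_def dl Let_def)
qed

definition astart :: "nat list \<Rightarrow> aconf" where
  "astart x = AC (Run Sim (tl_q0 P) (\<lambda>_. 0) 0) (\<lambda>j. if j < length x then x ! j else 0) 0 0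
     (\<lambda>_. 0) (\<lambda>_. 0) (\<lambda>_. 0) 0"

lemma astart_good:
  assumes "set x \<subseteq> tl_G P" "tl_q0 P \<noteq> tl_acc P"
  shows "gconf (astart x)"
  using assms wf nth_mem[of _ x] by (auto simp: astart_def tl_wf_def)

lemma siminv_start:
  assumes "set x \<subseteq> tl_G P" "tl_q0 P \<noteq> tl_acc P"
  shows "siminv S 0 (tl_init P x) (astart x)"
proof -
  have "core S 0 (\<lambda>_. 0) (\<lambda>_. 0) (\<lambda>_. 0) 0 0" by (simp add: core_def live_def pval_def)
  then show ?thesis using astart_good[OF assms] by (auto simp: siminv_def tl_init_def astart_def)
qed

text \<open>Amortisation with potential \<open>40 * k\<close>: a non-IO step costs at most 2 and
  raises the potential by 40; an IO step costs \<open>40 * (1 + k + S)\<close>, of which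
  \<open>40 * k\<close> is paid by resetting \<open>k\<close>.\<close>

lemma sim_run:
  assumes x: "set x \<subseteq> tl_G P"
    and addr: "\<And>i. i < N \<Longrightarrow> tl_is_io M P x i \<Longrightarrow> addr_of (atape (tl_run M P x (Suc i))) < S"
    and acc: "\<And>i. i < N \<Longrightarrow> cst (tl_run M P x i) \<noteq> tl_acc P"
    and "n < N"
  shows "\<exists>b k c. reach b (astart x) c \<and> siminv S k (tl_run M P x n) c \<and>
    b + 40 * k \<le> 80 * n + 40 * (S + 1) * tl_io M P x n"
  using \<open>n < N\<close>
proof (induction n)
  case 0
  then have "tl_q0 P \<noteq> tl_acc P" using acc[of 0] by (simp add: tl_run_def tl_init_def)
  then show ?case using siminv_start[OF x] reach_refl[of 0 "astart x"]
    by (intro exI[of _ 0] exI[of _ "astart x"]) (simp add: tl_run_def)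
next
  case (Suc n)
  then obtain b k c where r: "reach b (astart x) c" and inv: "siminv S k (tl_run M P x n) c" and
    b: "b + 40 * k \<le> 80 * n + 40 * (S + 1) * tl_io M P x n" by auto
  let ?io = "tl_is_io M P x n"
  have "\<exists>c'. reach (if ?io then 40 * (1 + k + S) else 2) c c' \<and>
    siminv S (if ?io then 0 else Suc k) (tl_run M P x (Suc n)) c'"
    by (rule sim_step[OF inv tl_run_Suc]) (use Suc.prems acc addr in \<open>auto simp: tl_is_io_def\<close>)
  then obtain c' where r': "reach (if ?io then 40 * (1 + k + S) else 2) c c'" and
    inv': "siminv S (if ?io then 0 else Suc k) (tl_run M P x (Suc n)) c'" by blast
  have "b + (if ?io then 40 * (1 + k + S) else 2) + 40 * (if ?io then 0 else Suc k)
      \<le> 80 * Suc n + 40 * (S + 1) * tl_io M P x (Suc n)"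
    using b by (simp add: tl_io_Suc algebra_simps)
  then show ?case using reach_trans[OF r r'] inv' by blast
qed

lemma sim_total:
  assumes x: "set x \<subseteq> tl_G P" and N: "cst (tl_run M P x N) = tl_acc P"
    and acc: "\<And>i. i < N \<Longrightarrow> cst (tl_run M P x i) \<noteq> tl_acc P" and "N \<noteq> 0"
  shows "\<exists>c. reach (80 * tl_time M P x N + 160 * (tl_io M P x N * tl_space M P x N)) (astart x) c \<and>
    acst c = Fin \<and> acX c = ext (tl_run M P x N)"
proof -
  let ?S = "tl_space M P x N" and ?io = "tl_io M P x N"
  have addr: "addr_of (atape (tl_run M P x (Suc i))) < ?S" if "i < N" "tl_is_io M P x i" for i
  proof -
    have "{addr_of (atape (tl_run M P x (Suc i))) |i. i < N \<and> tl_is_io M P x i} =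
        (\<lambda>i. addr_of (atape (tl_run M P x (Suc i)))) ` {i. i < N \<and> tl_is_io M P x i}" by blast
    then show ?thesis using that by (auto simp: tl_space_def less_Suc_eq_le intro!: Max_ge)
  qed
  obtain n where n: "N = Suc n" using \<open>N \<noteq> 0\<close> not0_implies_Suc by blast
  obtain b k c where r: "reach b (astart x) c" and inv: "siminv ?S k (tl_run M P x n) c" and
    b: "b + 40 * k \<le> 80 * n + 40 * (?S + 1) * tl_io M P x n"
    using sim_run[where N = N and n = n and S = ?S, OF x] addr acc n by blast
  have fin: "acst (astep c) = Fin \<and> acX (astep c) = ext (tl_run M P x N)"
    by (rule sim_last_step[OF inv]) (use N n in \<open>auto simp: tl_run_Suc\<close>)
  have NN: "N = tl_time M P x N + ?io" using tl_time_plus_io[of M P x N] by simp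
  have le: "tl_io M P x n \<le> ?io" using n by (simp add: tl_io_Suc)
  have "b + 1 \<le> 80 * N + 40 * (?S + 1) * tl_io M P x n" using b n by simp
  also have "\<dots> \<le> 80 * N + 40 * (?S + 1) * ?io" using le by (intro add_mono mult_mono) auto
  also have "\<dots> = 80 * tl_time M P x N + 120 * ?io + 40 * (?io * ?S)"
    by (subst NN) (simp add: algebra_simps)
  \<comment> \<open>With at least one IO operation the space is positive, so
    \<open>120 * ?io\<close> is at most \<open>120 * (?io * ?S)\<close>.\<close>
  also have "\<dots> \<le> 80 * tl_time M P x N + 160 * (?io * ?S)"
    using tl_space_pos[of M P x N] by (cases "?io = 0") auto
  finally show ?thesis using fin reach_mono[OF reach_trans[OF r reach_step[OF refl]]] by blast
qed

section \<open>Encoding as a seven-tape Turing machine\<close>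

definition enc :: "astate \<Rightarrow> nat" where
  "enc = (SOME f. inj_on f {z. gstate z})"

lemma inj_enc: "inj_on enc {z. gstate z}"
proof -
  have "\<exists>f :: astate \<Rightarrow> nat. inj_on f {z. gstate z}"
    using finite_imp_inj_to_nat_seg[OF finite_gstate] by blast
  then show ?thesis unfolding enc_def by (rule someI_ex)
qed

definition dec :: "nat \<Rightarrow> astate" where
  "dec = inv_into {z. gstate z} enc"

lemma dec_enc: "gstate z \<Longrightarrow> dec (enc z) = z"
  unfolding dec_def by (rule inv_into_f_f[OF inj_enc]) simp

definition Gam :: "nat set" where
  "Gam = tl_G P \<union> {0, 1, 2, 3}"

text \<open>Tapes: 0 external memory, 1 its left-end marker, 2 the unary counter (only a left-end marker),
  3 address, 4 suffix track, 5 prefix track, 6 left-end marker of the address tape. Heads 0--1 and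
  3--6 move together.\<close>
definition raw :: "astate \<Rightarrow> nat list \<Rightarrow> astate \<times> nat list \<times> dir list" where
  "raw z as = (if z = Start
     then (Run Sim (tl_q0 P) (\<lambda>_. 0) 0, [as ! 0, 1, 1, as ! 3, as ! 4, as ! 5, 1],
       [Stay, Stay, Stay, Stay, Stay, Stay, Stay])
     else case loc z (as ! 0) (as ! 1 = 1) (as ! 2 = 1) (as ! 3) (as ! 4) (as ! 5) (as ! 6 = 1) of
       (z', x, de, dv, a, s, p, da) \<Rightarrow>
         (z', [x, as ! 1, as ! 2, a, s, p, as ! 6], [de, de, dv, da, da, da, da]))"

text \<open>The \<open>else\<close> branch is a default for symbol tuples that never occur in a run;
  it makes \<open>tm_wf\<close> hold for all tuples.\<close>

definition mach :: tm where
  "mach = \<lparr>tm_k = 7, tm_Q = enc ` {z. gstate z}, tm_G = Gam, tm_q0 = enc Start, tm_qf = enc Fin,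
     tm_delta = (\<lambda>q as. case raw (dec q) as of (z, ws, ds) \<Rightarrow>
       if gstate z \<and> set ws \<subseteq> Gam then (enc z, ws, ds)
       else (enc Fin, replicate 7 0, replicate 7 Stay))\<rparr>"

lemma mach_wf: "tm_wf mach"
proof -
  have "length ws = 7 \<and> length ds = 7" if "raw z as = (z', ws, ds)" for z as z' ws ds
    using that by (auto simp: raw_def split: if_splits prod.splits)
  moreover have "finite Gam" using wf by (simp add: Gam_def tl_wf_def)
  moreover have "gstate Start" "gstate Fin" "0 \<in> Gam" by (auto simp: Gam_def)
  ultimately show ?thesis using finite_gstate
    by (auto simp: tm_wf_def mach_def split: prod.splits)
qed

definition lmark :: "nat \<Rightarrow> nat" where
  "lmark j = (if j = 0 then 1 else 0)"

fun tconf :: "aconf \<Rightarrow> tm_conf" where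
  "tconf (AC z X e v A s p h) = \<lparr>st = enc z,
     tp = (\<lambda>i. if i = 0 then X else if i = 1 \<or> i = 2 \<or> i = 6 then lmark else if i = 3 then A
               else if i = 4 then s else if i = 5 then p else (\<lambda>_. 0)),
     hd = (\<lambda>i. if i = 0 \<or> i = 1 then e else if i = 2 then v else if i < 7 then h else 0)\<rparr>"

lemma upt7: "[0..<7] = [0, 1, 2, 3, 4, 5, 6 :: nat]"
  by (simp add: upt_rec)

lemma less7: "(i :: nat) < 7 \<longleftrightarrow> i = 0 \<or> i = 1 \<or> i = 2 \<or> i = 3 \<or> i = 4 \<or> i = 5 \<or> i = 6"
  by auto

lemma tm_step_tconf:
  assumes "gconf c"
  shows "tm_step mach (tconf c) = tconf (astep c)"
proof (cases c)
  case (AC z X e v A s p h)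
  obtain z' x' de dv a' s' p' da
    where l: "loc z (X e) (e = 0) (v = 0) (A h) (s h) (p h) (h = 0) = (z', x', de, dv, a', s', p', da)"
    by (metis prod.exhaust)
  have gz: "gstate z" "z \<noteq> Start" using assms AC by auto
  have g: "gstate z' \<and> z' \<noteq> Start \<and> x' \<in> tl_G P \<and> a' \<le> 2 \<and> s' \<le> 1 \<and> p' \<le> 3"
    using loc_good[OF _ _ _ _ _ _ l] assms AC by simp
  show ?thesis
  proof (cases "z = Fin")
    case True
    then show ?thesis using AC by (simp add: tm_step_def mach_def)
  next
    case False
    have "gstate Fin" by simp
    then have ne: "enc z \<noteq> enc Fin" using False gz(1) dec_enc by metis
    let ?ws = "[x', lmark e, lmark v, a', s', p', lmark h]"
    have lm: "lmark j = 1 \<longleftrightarrow> j = 0" "lmark j \<in> Gam" for j by (auto simp: lmark_def Gam_def)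
    have "a' \<in> Gam" "s' \<in> Gam" "p' \<in> Gam" using g by (auto simp: Gam_def)
    then have ws: "set ?ws \<subseteq> Gam" using g lm by (auto simp: Gam_def)
    have "raw z [X e, lmark e, lmark v, A h, s h, p h, lmark h] = (z', ?ws, [de, de, dv, da, da, da, da])"
      using gz(2) lm l by (simp add: raw_def)
    then have d: "tm_delta mach (enc z) [X e, lmark e, lmark v, A h, s h, p h, lmark h]
        = (enc z', ?ws, [de, de, dv, da, da, da, da])"
      using g ws dec_enc[OF gz(1)] by (simp add: mach_def)
    have m: "map (\<lambda>i. tp (tconf c) i (hd (tconf c) i)) [0..<tm_k mach]
        = [X e, lmark e, lmark v, A h, s h, p h, lmark h]"
      using AC by (simp add: mach_def upt7)
    have k: "tm_k mach = 7" "tm_qf mach = enc Fin" by (simp_all add: mach_def)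
    show ?thesis unfolding tm_step_def m
      using ne d AC l by (auto simp: k less7 fun_eq_iff)
  qed
qed

lemma tm_step_init:
  assumes "set x \<subseteq> tl_G P" "tl_q0 P \<noteq> tl_acc P"
  shows "tm_step mach (tm_init mach x) = tconf (astart x)"
proof -
  have gs: "gstate Start" "gstate Fin" by auto
  then have ne: "enc Start \<noteq> enc Fin" using dec_enc by (metis astate.distinct(1))
  let ?X = "\<lambda>j. if j < length x then x ! j else 0"
  have "gconf (astart x)" by (rule astart_good[OF assms])
  then have g: "gstate (Run Sim (tl_q0 P) (\<lambda>_. 0) 0)" "\<forall>j. ?X j \<in> tl_G P" by (simp_all add: astart_def)
  then have X: "?X 0 \<in> tl_G P" by blast
  have d: "tm_delta mach (enc Start) [?X 0, 0, 0, 0, 0, 0, 0] =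
      (enc (Run Sim (tl_q0 P) (\<lambda>_. 0) 0), [?X 0, 1, 1, 0, 0, 0, 1],
       [Stay, Stay, Stay, Stay, Stay, Stay, Stay])"
    using g(1) X dec_enc[OF gs(1)] by (simp add: mach_def raw_def Gam_def del: gstate.simps)
  have m: "map (\<lambda>i. tp (tm_init mach x) i (hd (tm_init mach x) i)) [0..<tm_k mach]
        = [?X 0, 0, 0, 0, 0, 0, 0]"
    by (simp add: mach_def upt7 tm_init_def)
  have k: "tm_k mach = 7" "tm_qf mach = enc Fin" "tm_q0 mach = enc Start" by (simp_all add: mach_def)
  have st: "st (tm_init mach x) = enc Start" by (simp add: tm_init_def k)
  show ?thesis unfolding tm_step_def m st d using ne
    by (auto simp: k less7 fun_eq_iff tm_init_def astart_def lmark_def)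
qed

text \<open>The additional step is the one from \<open>Start\<close>, which writes the left-end
  markers.\<close>

lemma tm_run_tconf:
  assumes "set x \<subseteq> tl_G P" "tl_q0 P \<noteq> tl_acc P" "reach b (astart x) c"
  shows "\<exists>s\<le>Suc b. tm_run mach x s = tconf c"
proof -
  obtain n where n: "n \<le> b" "(astep ^^ n) (astart x) = c" using assms(3) unfolding reach_def by blast
  have "(tm_step mach ^^ n) (tconf (astart x)) = tconf ((astep ^^ n) (astart x)) \<and>
      gconf ((astep ^^ n) (astart x))" for n
    by (induction n) (auto simp: tm_step_tconf astep_good astart_good[OF assms(1,2)])
  then have "tm_run mach x (Suc n) = tconf c"
    using n(2) tm_step_init[OF assms(1,2)] by (simp add: tm_run_def funpow_Suc_right del: funpow.simps)
  then show ?thesis using n(1) by blast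
qed

lemma mach_halts:
  assumes x: "set x \<subseteq> tl_G P" and q0: "tl_q0 P \<noteq> tl_acc P"
    and N: "cst (tl_run M P x N) = tl_acc P" "\<And>i. i < N \<Longrightarrow> cst (tl_run M P x i) \<noteq> tl_acc P"
  shows "\<exists>s \<le> 240 * (tl_time M P x N + tl_io M P x N * tl_space M P x N).
    st (tm_run mach x s) = tm_qf mach \<and> tp (tm_run mach x s) 0 = ext (tl_run M P x N)"
proof -
  have N0: "N \<noteq> 0" using N(1) q0 by (cases N) (auto simp: tl_run_def tl_init_def)
  let ?b = "80 * tl_time M P x N + 160 * (tl_io M P x N * tl_space M P x N)"
  obtain c where c: "reach ?b (astart x) c" "acst c = Fin" "acX c = ext (tl_run M P x N)"
    using sim_total[OF x N N0] by blast
  obtain s where s: "s \<le> Suc ?b" "tm_run mach x s = tconf c"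
    using tm_run_tconf[OF x q0 c(1)] by blast
  \<comment> \<open>Some step occurs, and if it is an IO operation the space is positive too; so the
    sum is at least 1 and absorbs the \<open>Suc\<close>.\<close>
  have "0 < tl_time M P x N + tl_io M P x N * tl_space M P x N"
    using tl_time_plus_io[of M P x N] tl_space_pos[of M P x N] N0 by (cases "tl_io M P x N = 0") auto
  then have "s \<le> 240 * (tl_time M P x N + tl_io M P x N * tl_space M P x N)" using s(1)
    by (simp only: distrib_left)
  moreover have "st (tconf c) = tm_qf mach" "tp (tconf c) 0 = ext (tl_run M P x N)"
    using c(2,3) by (cases c; simp add: mach_def)+
  ultimately show ?thesis using s(2) by metis
qed

end

section \<open>Assembling the time bound\<close>

theorem theorem2:
  fixes M :: nat and P :: tlm and \<Sigma> :: "nat set" and f :: "nat list \<Rightarrow> nat list"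
    and T IO S :: "nat \<Rightarrow> nat"
  assumes "tlm_computes M P \<Sigma> f T IO S"
  shows "\<exists>P' :: tm. tm_computes_in_time P' \<Sigma> f (\<lambda>n. T n + IO n * S n)"
proof -
  have wf: "tl_wf M P" and \<Sigma>: "\<Sigma> \<subseteq> tl_G P" "0 \<notin> \<Sigma>" and
    f: "\<And>x. x \<in> lists \<Sigma> \<Longrightarrow> \<exists>s. cst (tl_run M P x s) = tl_acc P \<and> tape_word (ext (tl_run M P x s)) = f x"
    using assms unfolding tlm_computes_def by blast+
  obtain c N where bd: "\<And>x s. x \<in> lists \<Sigma> \<Longrightarrow> N \<le> length x \<Longrightarrow> cst (tl_run M P x s) = tl_acc P \<Longrightarrow>
      (\<And>i. i < s \<Longrightarrow> cst (tl_run M P x i) \<noteq> tl_acc P) \<Longrightarrow>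
      tl_time M P x s \<le> c * T (length x) \<and> tl_io M P x s \<le> c * IO (length x) \<and>
      tl_space M P x s \<le> c * S (length x)"
    using assms unfolding tlm_computes_def by blast
  \<comment> \<open>The resource bounds speak of the first accepting time; the output is the same
    there because accepting configurations are fixed.\<close>
  have first: "\<exists>s. cst (tl_run M P x s) = tl_acc P \<and> (\<forall>i<s. cst (tl_run M P x i) \<noteq> tl_acc P) \<and>
      tape_word (ext (tl_run M P x s)) = f x" if x: "x \<in> lists \<Sigma>" for x
  proof -
    obtain s where s: "cst (tl_run M P x s) = tl_acc P" "tape_word (ext (tl_run M P x s)) = f x"
      using f[OF x] by blast
    obtain r where r: "cst (tl_run M P x r) = tl_acc P" "\<forall>i<r. cst (tl_run M P x i) \<noteq> tl_acc P"
      using s(1) exists_least_iff[of "\<lambda>n. cst (tl_run M P x n) = tl_acc P"] by blast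
    have "r \<le> s" using r(2) s(1) not_less by blast
    then show ?thesis using tl_run_stable[OF r(1)] r s(2) by metis
  qed
  interpret tlm_sim M P by unfold_locales (rule wf)
  show ?thesis
  proof (cases "tl_q0 P = tl_acc P")
    case True
    \<comment> \<open>The time bound may be 0 here, so the machine must halt without any step.\<close>
    define P' where "P' = \<lparr>tm_k = 1, tm_Q = {0}, tm_G = insert 0 (tl_G P), tm_q0 = 0, tm_qf = 0,
      tm_delta = (\<lambda>q as. (0, as, [Stay]))\<rparr>"
    have "tm_wf P'" "\<Sigma> \<subseteq> tm_G P'" using wf \<Sigma>(1) by (auto simp: P'_def tm_wf_def tl_wf_def)
    moreover have "st (tm_run P' x 0) = tm_qf P'" for x by (simp add: P'_def tm_run_def tm_init_def)
    moreover have "tape_word (tp (tm_run P' x 0) 0) = f x" if x: "x \<in> lists \<Sigma>" for x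
    proof -
      have 0: "cst (tl_run M P x 0) = tl_acc P" using True by (simp add: tl_run_def tl_init_def)
      obtain s where s: "tape_word (ext (tl_run M P x s)) = f x" using f[OF x] by blast
      have "tl_run M P x s = tl_run M P x 0" by (rule tl_run_stable[OF 0]) simp
      moreover have "tp (tm_run P' x 0) 0 = ext (tl_run M P x 0)"
        by (simp add: tm_run_def tm_init_def tl_run_def tl_init_def)
      ultimately show ?thesis using s by simp
    qed
    ultimately have "tm_computes_in_time P' \<Sigma> f (\<lambda>n. T n + IO n * S n)"
      unfolding tm_computes_in_time_def using \<Sigma>(2) le0 by blast
    then show ?thesis by blast
  next
    case False
    have halts: "\<exists>s r. cst (tl_run M P x r) = tl_acc P \<and> (\<forall>i<r. cst (tl_run M P x i) \<noteq> tl_acc P) \<and>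
        s \<le> 240 * (tl_time M P x r + tl_io M P x r * tl_space M P x r) \<and>
        st (tm_run mach x s) = tm_qf mach \<and> tape_word (tp (tm_run mach x s) 0) = f x"
      if x: "x \<in> lists \<Sigma>" for x
    proof -
      obtain r where r: "cst (tl_run M P x r) = tl_acc P" "\<forall>i<r. cst (tl_run M P x i) \<noteq> tl_acc P"
        "tape_word (ext (tl_run M P x r)) = f x" using first[OF x] by blast
      have "set x \<subseteq> tl_G P" using x \<Sigma>(1) by auto
      from mach_halts[OF this False r(1)] r(2) show ?thesis using r by metis
    qed
    have "\<exists>s \<le> 240 * (c + c * c) * (T (length x) + IO (length x) * S (length x)).
        st (tm_run mach x s) = tm_qf mach" if x: "x \<in> lists \<Sigma>" "N \<le> length x" for x
    proof -
      let ?T = "T (length x)" and ?IO = "IO (length x)" and ?S = "S (length x)"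
      obtain s r where r: "cst (tl_run M P x r) = tl_acc P" "\<forall>i<r. cst (tl_run M P x i) \<noteq> tl_acc P"
        and s: "s \<le> 240 * (tl_time M P x r + tl_io M P x r * tl_space M P x r)"
        "st (tm_run mach x s) = tm_qf mach"
        using halts[OF x(1)] by blast
      have b: "tl_time M P x r \<le> c * ?T" "tl_io M P x r \<le> c * ?IO" "tl_space M P x r \<le> c * ?S"
        using bd[OF x r(1)] r(2) by auto
      \<comment> \<open>The product of two bounds with factor \<open>c\<close> brings in
        \<open>c * c\<close>.\<close>
      have "tl_time M P x r + tl_io M P x r * tl_space M P x r \<le> c * ?T + (c * ?IO) * (c * ?S)"
        by (intro add_mono mult_mono b) auto
      also have "\<dots> \<le> (c + c * c) * (?T + ?IO * ?S)" by (simp add: algebra_simps)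
      finally have "240 * (tl_time M P x r + tl_io M P x r * tl_space M P x r)
          \<le> 240 * (c + c * c) * (?T + ?IO * ?S)" unfolding mult.assoc[of 240] by (rule mult_le_mono2)
      then show ?thesis using s order_trans by blast
    qed
    moreover have "\<Sigma> \<subseteq> tm_G mach" using \<Sigma>(1) by (auto simp: mach_def Gam_def)
    ultimately have "tm_computes_in_time mach \<Sigma> f (\<lambda>n. T n + IO n * S n)"
      unfolding tm_computes_in_time_def using mach_wf \<Sigma>(2) halts by blast
    then show ?thesis by blast
  qed
qed

end
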